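(* Let $k\ge 2$ and let $\mathcal{G}_k$ be a generic ultrafilter forced by $\mathcal{P}(\omega^k)/\mathrm{Fin}^{\otimes k}$. In $V[\mathcal{G}_k]$: if $\mathcal{V}$ is a nonprincipal ultrafilter with $\mathcal{V}\le_{RK}\mathcal{G}_k$, then $\mathcal{V}\equiv_{RK}\pi_l(\mathcal{G}_k)$ for some $l\le k$.
   Context: $\mathrm{Fin}^{\otimes 1}$ is the ideal of finite subsets of $\omega$; $\mathrm{Fin}^{\otimes(k+1)}$ is the ideal of all $X\subseteq\omega^{k+1}$ such that for all but finitely many $i$, $\{(j_1,\dots,j_k):(i,j_1,\dots,j_k)\in X\}\in\mathrm{Fin}^{\otimes k}$. $\mathcal{G}_k$ is an ultrafilter on $\omega^k$; identify $[\omega]^k$ with the strictly increasing $k$-tuples in $\omega^k$. The space $\mathcal{E}_k$: let $\omega^{\not\downarrow\le k}$ be the set of non-decreasing sequences of natural numbers of length $\le k$ (including $()$), $\omega^{\not\downarrow k}$ those of length exactly $k$. Well-order $\omega^{\not\downarrow\le k}$ by $\prec$: $()$ is least, and for nonempty $(j_0,\dots,j_{p-1}),(l_0,\dots,l_{q-1})$, $(j_0,\dots,j_{p-1})\prec(l_0,\dots,l_{q-1})$ iff $j_{p-1}<l_{q-1}$, or $j_{p-1}=l_{q-1}$ and $(j_0,\dots,j_{p-1})$ is lexicographically below $(l_0,\dots,l_{q-1})$ (a proper initial segment counts as below). Let $\vec j_m$ be its $m$-th element, $m_{\vec l}$ the index of $\vec l$, and $\vec i_n$ the $n$-th element of $\omega^{\not\downarrow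 k}$ under $\prec$. Put $\mathbb{W}_k(\vec j)=\{m_{\vec j\restriction q}:1\le q\le|\vec j|\}$, $\widehat{\mathbb{W}}_k=\{\mathbb{W}_k(\vec j):\vec j\in\omega^{\not\downarrow\le k}\}$, $\mathbb{W}_k=\{\mathbb{W}_k(\vec i):\vec i\in\omega^{\not\downarrow k}\}$. An $\mathcal{E}_k$-tree is $\hat X:\omega^{\not\downarrow\le k}\to\widehat{\mathbb{W}}_k$ with (i) $|\hat X(\vec j_m)|=|\vec j_m|$; (ii) $\max\hat X(\vec j_m)<\max\hat X(\vec j_{m+1})$ for $m\ge1$; (iii) $\hat X(\vec j_m)$ is a proper initial segment of $\hat X(\vec j_n)$ iff $\vec j_m$ is a proper initial segment of $\vec j_n$. $\mathcal{E}_k$ is the set of restrictions of $\mathcal{E}_k$-trees to $\omega^{\not\downarrow k}$, each identified with its range $\subseteq[\omega]^k$. $\mathcal{B}_k=\mathcal{G}_k\cap\mathcal{E}_k$. For $0\le l\le k$ and a finite $w\subseteq\omega$ with $\ge l$ elements, $\pi_l(w)$ is the set of its $l$ smallest elements; $\pi_l(S)=\{\pi_l(w):w\in S\}$. $\pi_l(\mathcal{G}_k)$ is the filter on $\pi_l(\mathbb{W}_k)$ generated by $\{\pi_l(X):X\in\mathcal{B}_k\}$. Rudin–Keisler: $\mathcal{V}\le_{RK}\mathcal{U}$ iff there is a function $h$ with $\mathcal{V}=\{A:h^{-1}(A)\in\mathcal{U}\}$; $\equiv_{RK}$ means reducibility in both directions.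
   Formalization: The formal theorem adds the hypothesis that W_k (as increasing k-tuples) belongs to G_k; if the complement of W_k is in G_k, then B_k is empty, π_l(G_k) is the trivial filter, and the claim fails for V = G_k. *)

theory Defs
  imports Main "HOL-Library.Sublist"
begin

section \<open>The forcing relation\<close>

text \<open>
  Truth in the generic extension is rendered by the forcing relation over the ground universe.
  A forcing notion is a preorder \<open>R\<close> with set of conditions \<open>Field R\<close>, where \<open>(q, p) \<in> R\<close>
  means that \<open>q\<close> is stronger than \<open>p\<close>. A formula of the forcing language is represented by the
  set of conditions forcing it; the clauses for negation, conjunction and the universal
  quantifier are the usual recursive ones, and the other connectives are classical
  abbreviations. A statement holds in every generic extension iff all conditions force it.
\<close>

definition forced :: "'p rel \<Rightarrow> 'p set \<Rightarrow> bool" where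
  "forced R \<phi> \<longleftrightarrow> (\<forall>p\<in>Field R. p \<in> \<phi>)"

definition fneg :: "'p rel \<Rightarrow> 'p set \<Rightarrow> 'p set"  ("\<^bold>\<not>\<^bsub>_\<^esub> _" [0, 40] 40) where
  "(\<^bold>\<not>\<^bsub>R\<^esub> \<phi>) = {p. \<forall>q. (q, p) \<in> R \<longrightarrow> q \<notin> \<phi>}"

definition fand :: "'p set \<Rightarrow> 'p set \<Rightarrow> 'p set"  (infixr "\<^bold>\<and>" 35) where
  "(\<phi> \<^bold>\<and> \<psi>) = {p. p \<in> \<phi> \<and> p \<in> \<psi>}"

definition fall :: "('x \<Rightarrow> 'p set) \<Rightarrow> 'p set"  (binder "\<^bold>\<forall>" 10) where
  "(\<^bold>\<forall>x. \<phi> x) = {p. \<forall>x. p \<in> \<phi> x}"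

definition f_or :: "'p set \<Rightarrow> 'p rel \<Rightarrow> 'p set \<Rightarrow> 'p set"  ("_ \<^bold>\<or>\<^bsub>_\<^esub> _" [31, 0, 30] 30) where
  "(\<phi> \<^bold>\<or>\<^bsub>R\<^esub> \<psi>) = (\<^bold>\<not>\<^bsub>R\<^esub> ((\<^bold>\<not>\<^bsub>R\<^esub> \<phi>) \<^bold>\<and> (\<^bold>\<not>\<^bsub>R\<^esub> \<psi>)))"

definition fimp :: "'p set \<Rightarrow> 'p rel \<Rightarrow> 'p set \<Rightarrow> 'p set"  ("_ \<^bold>\<longrightarrow>\<^bsub>_\<^esub> _" [26, 0, 25] 25) where
  "(\<phi> \<^bold>\<longrightarrow>\<^bsub>R\<^esub> \<psi>) = (\<^bold>\<not>\<^bsub>R\<^esub> (\<phi> \<^bold>\<and> (\<^bold>\<not>\<^bsub>R\<^esub> \<psi>)))"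

definition fiff :: "'p set \<Rightarrow> 'p rel \<Rightarrow> 'p set \<Rightarrow> 'p set"  ("_ \<^bold>\<longleftrightarrow>\<^bsub>_\<^esub> _" [26, 0, 25] 25) where
  "(\<phi> \<^bold>\<longleftrightarrow>\<^bsub>R\<^esub> \<psi>) = ((\<phi> \<^bold>\<longrightarrow>\<^bsub>R\<^esub> \<psi>) \<^bold>\<and> (\<psi> \<^bold>\<longrightarrow>\<^bsub>R\<^esub> \<phi>))"

definition fex :: "'p rel \<Rightarrow> ('x \<Rightarrow> 'p set) \<Rightarrow> 'p set" where
  "fex R \<phi> = (\<^bold>\<not>\<^bsub>R\<^esub> (\<^bold>\<forall>x. \<^bold>\<not>\<^bsub>R\<^esub> \<phi> x))"

text \<open>An assertion about elements of the ground universe.\<close>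

definition gnd :: "bool \<Rightarrow> 'p set" where
  "gnd b = {p. b}"

text \<open>
  Every subset (in the extension) of a ground set has a name consisting of pairs of a condition
  and a ground element, and every family of such subsets has a name consisting of pairs of a
  condition and a name of this kind. Quantifying over a type of names is thus
  quantifying over the corresponding power set of the extension. Bound variables of ground
  type range over the elements of a ground set.
\<close>

type_synonym ('p, 'a) nm = "('p \<times> 'a) set"
type_synonym ('p, 'a) fam = "('p \<times> ('p, 'a) nm) set"

definition fmem :: "'p rel \<Rightarrow> 'a \<Rightarrow> ('p, 'a) nm \<Rightarrow> 'p set" where
  "fmem R x \<tau> = {p. \<forall>q. (q, p) \<in> R \<longrightarrow> (\<exists>s r. (s, q) \<in> R \<and> (s, r) \<in> R \<and> (r, x) \<in> \<tau>)}"

definition fsub :: "'p rel \<Rightarrow> ('p, 'a) nm \<Rightarrow> ('p, 'a) nm \<Rightarrow> 'p set" where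
  "fsub R \<sigma> \<tau> = (\<^bold>\<forall>x. fmem R x \<sigma> \<^bold>\<longrightarrow>\<^bsub>R\<^esub> fmem R x \<tau>)"

definition feq :: "'p rel \<Rightarrow> ('p, 'a) nm \<Rightarrow> ('p, 'a) nm \<Rightarrow> 'p set" where
  "feq R \<sigma> \<tau> = (\<^bold>\<forall>x. fmem R x \<sigma> \<^bold>\<longleftrightarrow>\<^bsub>R\<^esub> fmem R x \<tau>)"

text \<open>The formula \<open>\<tau> \<in> F\<close>; \<open>fmem2 R F\<close> is the family named by \<open>F\<close> as a predicate on names.\<close>

definition fmem2 :: "'p rel \<Rightarrow> ('p, 'a) fam \<Rightarrow> ('p, 'a) nm \<Rightarrow> 'p set" where
  "fmem2 R F \<tau> = {p. \<forall>q. (q, p) \<in> R \<longrightarrow>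
     (\<exists>s r \<sigma>. (s, q) \<in> R \<and> (s, r) \<in> R \<and> (r, \<sigma>) \<in> F \<and> s \<in> feq R \<tau> \<sigma>)}"

text \<open>The canonical name of a ground set, and the name of the image of a named set under a
  ground function.\<close>

definition chk :: "'p rel \<Rightarrow> 'a set \<Rightarrow> ('p, 'a) nm" where
  "chk R X = Field R \<times> X"

definition nimage :: "('a \<Rightarrow> 'b) \<Rightarrow> ('p, 'a) nm \<Rightarrow> ('p, 'b) nm" where
  "nimage f \<tau> = {(p, f x) | p x. (p, x) \<in> \<tau>}"


section \<open>Filters and the Rudin--Keisler order in the extension\<close>

definition is_filter_on :: "'p rel \<Rightarrow> 'a set \<Rightarrow> (('p, 'a) nm \<Rightarrow> 'p set) \<Rightarrow> 'p set" where
  "is_filter_on R S F =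
     ((\<^bold>\<forall>A. F A \<^bold>\<longrightarrow>\<^bsub>R\<^esub> fsub R A (chk R S)) \<^bold>\<and>
      F (chk R S) \<^bold>\<and>
      (\<^bold>\<not>\<^bsub>R\<^esub> F (chk R {})) \<^bold>\<and>
      (\<^bold>\<forall>A. \<^bold>\<forall>B. (F A \<^bold>\<and> fsub R A B \<^bold>\<and> fsub R B (chk R S)) \<^bold>\<longrightarrow>\<^bsub>R\<^esub> F B) \<^bold>\<and>
      (\<^bold>\<forall>A. \<^bold>\<forall>B. \<^bold>\<forall>C. (F A \<^bold>\<and> F B \<^bold>\<and> (\<^bold>\<forall>x. fmem R x C \<^bold>\<longleftrightarrow>\<^bsub>R\<^esub> (fmem R x A \<^bold>\<and> fmem R x B)))
         \<^bold>\<longrightarrow>\<^bsub>R\<^esub> F C))"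

definition is_ultrafilter_on :: "'p rel \<Rightarrow> 'a set \<Rightarrow> (('p, 'a) nm \<Rightarrow> 'p set) \<Rightarrow> 'p set" where
  "is_ultrafilter_on R S F =
     (is_filter_on R S F \<^bold>\<and>
      (\<^bold>\<forall>A. \<^bold>\<forall>B. (fsub R A (chk R S) \<^bold>\<and>
         (\<^bold>\<forall>x. fmem R x B \<^bold>\<longleftrightarrow>\<^bsub>R\<^esub> (gnd (x \<in> S) \<^bold>\<and> (\<^bold>\<not>\<^bsub>R\<^esub> fmem R x A))))
         \<^bold>\<longrightarrow>\<^bsub>R\<^esub> (F A \<^bold>\<or>\<^bsub>R\<^esub> F B)))"

definition is_nonprincipal_on :: "'p rel \<Rightarrow> 'a set \<Rightarrow> (('p, 'a) nm \<Rightarrow> 'p set) \<Rightarrow> 'p set" where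
  "is_nonprincipal_on R S F = (\<^bold>\<forall>x. gnd (x \<in> S) \<^bold>\<longrightarrow>\<^bsub>R\<^esub> (\<^bold>\<not>\<^bsub>R\<^esub> F (chk R {x})))"

text \<open>The smallest filter on \<open>S\<close> that contains the family \<open>B\<close>.\<close>

definition filter_gen :: "'p rel \<Rightarrow> 'a set \<Rightarrow> (('p, 'a) nm \<Rightarrow> 'p set) \<Rightarrow> ('p, 'a) nm \<Rightarrow> 'p set" where
  "filter_gen R S B A =
     (fsub R A (chk R S) \<^bold>\<and>
      (\<^bold>\<forall>F. (is_filter_on R S (fmem2 R F) \<^bold>\<and> (\<^bold>\<forall>C. B C \<^bold>\<longrightarrow>\<^bsub>R\<^esub> fmem2 R F C))
         \<^bold>\<longrightarrow>\<^bsub>R\<^esub> fmem2 R F A))"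

definition is_function :: "'p rel \<Rightarrow> 'a set \<Rightarrow> 'b set \<Rightarrow> ('p, 'a \<times> 'b) nm \<Rightarrow> 'p set" where
  "is_function R S T h =
     (fsub R h (chk R (S \<times> T)) \<^bold>\<and>
      (\<^bold>\<forall>x. gnd (x \<in> S) \<^bold>\<longrightarrow>\<^bsub>R\<^esub> fex R (\<lambda>y. fmem R (x, y) h)) \<^bold>\<and>
      (\<^bold>\<forall>x. \<^bold>\<forall>y. \<^bold>\<forall>z. (fmem R (x, y) h \<^bold>\<and> fmem R (x, z) h) \<^bold>\<longrightarrow>\<^bsub>R\<^esub> gnd (y = z)))"

text \<open>\<open>rk_le R T V S U\<close>: the family \<open>V\<close> of subsets of \<open>T\<close> is Rudin--Keisler below the
  family \<open>U\<close> of subsets of \<open>S\<close>. In the definition \<open>P\<close> is the preimage of \<open>A\<close> under \<open>h\<close>.\<close>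

definition rk_le :: "'p rel \<Rightarrow> 'b set \<Rightarrow> (('p, 'b) nm \<Rightarrow> 'p set) \<Rightarrow>
    'a set \<Rightarrow> (('p, 'a) nm \<Rightarrow> 'p set) \<Rightarrow> 'p set" where
  "rk_le R T V S U = fex R (\<lambda>h. is_function R S T h \<^bold>\<and>
     (\<^bold>\<forall>A. \<^bold>\<forall>P. (fsub R A (chk R T) \<^bold>\<and>
        (\<^bold>\<forall>x. fmem R x P \<^bold>\<longleftrightarrow>\<^bsub>R\<^esub> fex R (\<lambda>y. fmem R (x, y) h \<^bold>\<and> fmem R y A)))
        \<^bold>\<longrightarrow>\<^bsub>R\<^esub> (V A \<^bold>\<longleftrightarrow>\<^bsub>R\<^esub> U P)))"

definition rk_equiv :: "'p rel \<Rightarrow> 'b set \<Rightarrow> (('p, 'b) nm \<Rightarrow> 'p set) \<Rightarrow>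
    'a set \<Rightarrow> (('p, 'a) nm \<Rightarrow> 'p set) \<Rightarrow> 'p set" where
  "rk_equiv R T V S U = (rk_le R T V S U \<^bold>\<and> rk_le R S U T V)"


section \<open>The forcing notion\<close>

definition omega_pow :: "nat \<Rightarrow> nat list set" where
  "omega_pow k = {xs. length xs = k}"

text \<open>The ideal is meant for \<open>k \<ge> 1\<close>; the value at \<open>0\<close> is immaterial.\<close>

fun fin_tensor :: "nat \<Rightarrow> nat list set set" where
  "fin_tensor 0 = {{}}"
| "fin_tensor (Suc 0) = {X. X \<subseteq> omega_pow 1 \<and> finite X}"
| "fin_tensor (Suc (Suc k)) =
     {X. X \<subseteq> omega_pow (Suc (Suc k)) \<and> finite {i. {js. i # js \<in> X} \<notin> fin_tensor (Suc k)}}"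

definition fin_tensor_equiv :: "nat \<Rightarrow> nat list set rel" where
  "fin_tensor_equiv k = {(X, Y). X \<subseteq> omega_pow k \<and> Y \<subseteq> omega_pow k \<and>
     (X - Y) \<union> (Y - X) \<in> fin_tensor k}"

text \<open>The nonzero elements of the quotient Boolean algebra.\<close>

definition fin_quotient :: "nat \<Rightarrow> nat list set set set" where
  "fin_quotient k = Pow (omega_pow k) // fin_tensor_equiv k - {fin_tensor_equiv k `` {{}}}"

definition fin_forcing :: "nat \<Rightarrow> nat list set set rel" where
  "fin_forcing k = {(c, d). c \<in> fin_quotient k \<and> d \<in> fin_quotient k \<and>
     (\<exists>X\<in>c. \<exists>Y\<in>d. X - Y \<in> fin_tensor k)}"

text \<open>The name of the family of all \<open>X\<close> whose class belongs to the generic filter.\<close>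

definition generic_name :: "nat \<Rightarrow> (nat list set set, nat list) fam" where
  "generic_name k = {(c, chk (fin_forcing k) X) | c X. c \<in> fin_quotient k \<and> X \<in> c}"

definition generic_uf :: "nat \<Rightarrow> (nat list set set, nat list) nm \<Rightarrow> nat list set set set" where
  "generic_uf k = fmem2 (fin_forcing k) (generic_name k)"


section \<open>The space \<open>\<E>\<^sub>k\<close>\<close>

definition nd_le :: "nat \<Rightarrow> nat list set" where
  "nd_le k = {xs. sorted xs \<and> length xs \<le> k}"

definition nd_eq :: "nat \<Rightarrow> nat list set" where
  "nd_eq k = {xs. sorted xs \<and> length xs = k}"

definition prec :: "nat list \<Rightarrow> nat list \<Rightarrow> bool" where
  "prec js ls \<longleftrightarrow> ls \<noteq> [] \<and>
     (js = [] \<or> last js < last ls \<or> (last js = last ls \<and> (js, ls) \<in> lexord less_than))"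

definition nd_index :: "nat \<Rightarrow> nat list \<Rightarrow> nat" where
  "nd_index k ls = card {js \<in> nd_le k. prec js ls}"

definition nd_nth :: "nat \<Rightarrow> nat \<Rightarrow> nat list" where
  "nd_nth k m = (THE ls. ls \<in> nd_le k \<and> nd_index k ls = m)"

definition W_of :: "nat \<Rightarrow> nat list \<Rightarrow> nat set" where
  "W_of k js = {nd_index k (take q js) | q. 1 \<le> q \<and> q \<le> length js}"

definition W_hat :: "nat \<Rightarrow> nat set set" where
  "W_hat k = W_of k ` nd_le k"

definition W_set :: "nat \<Rightarrow> nat set set" where
  "W_set k = W_of k ` nd_eq k"

definition proper_init_seg :: "nat set \<Rightarrow> nat set \<Rightarrow> bool" where
  "proper_init_seg a b \<longleftrightarrow> a \<subset> b \<and> (\<forall>x\<in>a. \<forall>y\<in>b. y \<le> x \<longrightarrow> y \<in> a)"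

definition is_E_tree :: "'p rel \<Rightarrow> nat \<Rightarrow> ('p, nat list \<times> nat set) nm \<Rightarrow> 'p set" where
  "is_E_tree R k H =
     (is_function R (nd_le k) (W_hat k) H \<^bold>\<and>
      (\<^bold>\<forall>m. \<^bold>\<forall>w. fmem R (nd_nth k m, w) H \<^bold>\<longrightarrow>\<^bsub>R\<^esub> gnd (card w = length (nd_nth k m))) \<^bold>\<and>
      (\<^bold>\<forall>m. \<^bold>\<forall>v. \<^bold>\<forall>w. (gnd (m \<ge> 1) \<^bold>\<and> fmem R (nd_nth k m, v) H \<^bold>\<and> fmem R (nd_nth k (m + 1), w) H)
         \<^bold>\<longrightarrow>\<^bsub>R\<^esub> gnd (Max v < Max w)) \<^bold>\<and>
      (\<^bold>\<forall>m. \<^bold>\<forall>n. \<^bold>\<forall>v. \<^bold>\<forall>w. (fmem R (nd_nth k m, v) H \<^bold>\<and> fmem R (nd_nth k n, w) H)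
         \<^bold>\<longrightarrow>\<^bsub>R\<^esub> gnd (proper_init_seg v w \<longleftrightarrow> strict_prefix (nd_nth k m) (nd_nth k n))))"

definition in_E :: "'p rel \<Rightarrow> nat \<Rightarrow> ('p, nat set) nm \<Rightarrow> 'p set" where
  "in_E R k X = fex R (\<lambda>H. is_E_tree R k H \<^bold>\<and>
     (\<^bold>\<forall>w. fmem R w X \<^bold>\<longleftrightarrow>\<^bsub>R\<^esub> fex R (\<lambda>js. gnd (js \<in> nd_eq k) \<^bold>\<and> fmem R (js, w) H)))"

text \<open>A finite set of naturals is identified with its increasing enumeration. The family
  \<open>\<B>\<^sub>k\<close> is the intersection of \<open>\<G>\<^sub>k\<close> and \<open>\<E>\<^sub>k\<close>.\<close>

definition in_B :: "nat \<Rightarrow> (nat list set set, nat set) nm \<Rightarrow> nat list set set set" where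
  "in_B k X = (in_E (fin_forcing k) k X \<^bold>\<and> generic_uf k (nimage sorted_list_of_set X))"

definition pi_proj :: "nat \<Rightarrow> nat set \<Rightarrow> nat set" where
  "pi_proj l w = set (take l (sorted_list_of_set w))"

definition pi_generic :: "nat \<Rightarrow> nat \<Rightarrow> (nat list set set, nat set) nm \<Rightarrow> nat list set set set" where
  "pi_generic k l = filter_gen (fin_forcing k) (pi_proj l ` W_set k)
     (\<lambda>C. fex (fin_forcing k)
        (\<lambda>X. in_B k X \<^bold>\<and> feq (fin_forcing k) C (nimage (pi_proj l) X)))"

text \<open>\<open>\<W>\<^sub>k \<in> \<G>\<^sub>k\<close>. All members of \<open>\<E>\<^sub>k\<close> are subsets of \<open>\<W>\<^sub>k\<close>, whose complement in \<open>\<omega>\<^sup>k\<close> is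
  positive; without this \<open>\<B>\<^sub>k\<close> would be empty and would not generate \<open>\<G>\<^sub>k\<close>.\<close>

definition W_in_generic :: "nat \<Rightarrow> nat list set set set" where
  "W_in_generic k = generic_uf k (chk (fin_forcing k) (sorted_list_of_set ` W_set k))"

end

theory Submission
  imports Defs "HOL-Library.Countable_Set"
begin

text \<open>
  The forcing is \<open>\<sigma>\<close>-closed, since a diagonal union of columns of a decreasing sequence of positive
  sets is almost contained in each of them. Hence a function on \<open>\<omega>\<^sup>k\<close> in the extension is densely
  decided to be a ground model function \<open>f\<close>, and a subset of a countable ground set is densely decided
  to be a ground set. By induction on \<open>k\<close>, every positive set has a positive subset \<open>Y\<close> on which
  \<open>f x = f y\<close> holds exactly when \<open>x\<close> and \<open>y\<close> agree in their first \<open>l\<close> coordinates, for some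
  \<open>l \<le> k\<close>; below \<open>Y\<close> the image of \<open>\<G>\<^sub>k\<close> under \<open>f\<close> is thus isomorphic to its image under \<open>\<pi>\<^sub>l\<close>.
  Finally, every positive subset of \<open>\<W>\<^sub>k\<close> contains a positive member of \<open>\<E>\<^sub>k\<close>, so the image of
  \<open>\<G>\<^sub>k\<close> under \<open>\<pi>\<^sub>l\<close> is the filter generated by the projections of the members of \<open>\<B>\<^sub>k\<close>.
\<close>

section \<open>Positive sets and canonization\<close>

text \<open>The statement quantifies over arbitrary names, while canonization and trees live in the
  ground model. They meet in \<open>below k c X\<close>: once a name is decided to be a ground set,
  its membership in an image of the generic ultrafilter reduces to \<open>below\<close>. Deciding
  works over countable ground sets, but \<open>S\<close> may be uncountable, so names for subsets of
  \<open>S\<close> are never decided. Instead, a decided reduction \<open>f\<close> turns membership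
  of \<open>A\<close> in \<open>V\<close> into a question about the preimage of \<open>A\<close>, a
  subset of the countable set omega^k. \<open>pushforward\<close> expresses both \<open>V\<close>
  and the projected ultrafilter in terms of such sets, and \<open>pushforward_transfer\<close>
  compares them. The type \<open>l\<close> depends on the positive set reached, hence on the
  condition. This is enough, because an existential statement is forced as soon as witnesses exist
  densely often. Membership of W_k in the ultrafilter lets all work take place on strictly
  increasing tuples. There the set of the first \<open>l\<close> entries determines these entries,
  so that the projection of finite sets and \<open>take l\<close> on lists have the same
  fibres.\<close>

fun pos :: "nat \<Rightarrow> nat list set \<Rightarrow> bool" where
  "pos 0 X \<longleftrightarrow> [] \<in> X"
| "pos (Suc k) X \<longleftrightarrow> infinite {i. pos k {js. i # js \<in> X}}"

lemma pos_mono: "pos k X \<Longrightarrow> X \<subseteq> Y \<Longrightarrow> pos k Y"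
proof (induction k arbitrary: X Y)
  case (Suc k)
  have "{i. pos k {js. i # js \<in> X}} \<subseteq> {i. pos k {js. i # js \<in> Y}}"
    using Suc.IH Suc.prems(2) by (smt (verit) Collect_mono subset_iff)
  then show ?case using Suc.prems(1) by (auto dest: finite_subset)
qed auto

text \<open>A column of a union is the union of the columns, and an infinite index set is not
  covered by two finite ones. Contrapositively, the non-positive sets are closed under
  unions.\<close>

lemma pos_Un: "pos k (X \<union> Y) \<Longrightarrow> pos k X \<or> pos k Y"
proof (induction k arbitrary: X Y)
  case (Suc k)
  have "{i. pos k {js. i # js \<in> X \<union> Y}} \<subseteq> {i. pos k {js. i # js \<in> X}} \<union> {i. pos k {js. i # js \<in> Y}}"
  proof (safe)
    fix i assume a: "pos k {js. i # js \<in> X \<union> Y}" "\<not> pos k {js. i # js \<in> Y}"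
    have "{js. i # js \<in> X \<union> Y} = {js. i # js \<in> X} \<union> {js. i # js \<in> Y}" by auto
    with a Suc.IH show "pos k {js. i # js \<in> X}" by metis
  qed
  then show ?case using Suc.prems by (auto dest: finite_subset)
qed auto

lemma not_pos_empty [simp]: "\<not> pos k {}"
  by (induction k) auto

lemma pos_nonempty: "pos k X \<Longrightarrow> \<exists>x\<in>X. length x = k"
proof (induction k arbitrary: X)
  case (Suc k)
  then have "{i. pos k {js. i # js \<in> X}} \<noteq> {}" by force
  then obtain i where "pos k {js. i # js \<in> X}" by blast
  from Suc.IH[OF this] show ?case by force
qed auto

text \<open>The recursion of \<open>pos\<close> starts one level lower than that of
  \<open>fin_tensor\<close>, so case 2 matches finiteness of a set of one-element lists with
  finiteness of the set of their entries. Lists of the wrong length are invisible to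
  \<open>pos\<close>, whereas the ideal contains only subsets of \<open>omega_pow k\<close>.\<close>

lemma fin_tensor_iff_not_pos: "X \<subseteq> omega_pow k \<Longrightarrow> X \<in> fin_tensor k \<longleftrightarrow> \<not> pos k X"
proof (induction k arbitrary: X rule: fin_tensor.induct)
  case 1
  then show ?case by (auto simp: omega_pow_def)
next
  case 2
  have "X = (\<lambda>i. [i]) ` {i. [i] \<in> X}"
    using 2 by (auto simp: omega_pow_def length_Suc_conv image_iff)
  moreover have "finite ((\<lambda>i. [i]) ` {i. [i] \<in> X}) \<longleftrightarrow> finite {i. [i] \<in> X}"
    by (intro finite_image_iff inj_onI) auto
  ultimately show ?case using 2 by simp
next
  case (3 k)
  have "{js. i # js \<in> X} \<subseteq> omega_pow (Suc k)" for i
    using 3(2) by (auto simp: omega_pow_def)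
  then show ?case using 3 by simp
qed

section \<open>Diagonalization along decreasing sequences and disjoint refinements\<close>

lemma infinite_family_increasing_choice:
  fixes A :: "nat \<Rightarrow> nat set"
  assumes "\<And>n. infinite (A n)"
  shows "\<exists>i. strict_mono i \<and> (\<forall>n. i n \<in> A n)"
proof -
  have "\<exists>y. y \<in> A (Suc n) \<and> x < y" for x n
    using assms[of "Suc n"] by (auto simp: infinite_nat_iff_unbounded)
  moreover have "\<exists>x. x \<in> A 0" using assms[of 0] by (metis ex_in_conv finite.emptyI)
  ultimately obtain i where "\<forall>n. i n \<in> A n \<and> i n < i (Suc n)"
    using dependent_nat_choice[of "\<lambda>n x. x \<in> A n" "\<lambda>n x y. x < y"] by metis
  then show ?thesis by (auto simp: strict_mono_Suc_iff)
qed

lemma pos_pseudo_intersection: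
  assumes pos: "\<And>n. pos (Suc k) (X n)" and dec: "\<And>n. X (Suc n) \<subseteq> X n"
  shows "\<exists>Z\<subseteq>X 0. pos (Suc k) Z \<and> (\<forall>n. \<not> pos (Suc k) (Z - X n))"
proof -
  obtain i where i: "strict_mono i" "\<And>n. pos k {js. i n # js \<in> X n}"
    using infinite_family_increasing_choice[of "\<lambda>n. {i. pos k {js. i # js \<in> X n}}"] pos by auto
  have mono: "X n \<subseteq> X m" if "m \<le> n" for m n
    using dec that by (rule lift_Suc_antimono_le)
  define Z where "Z = (\<Union>n. {i n # js |js. i n # js \<in> X n})"
  have "pos k {js. i n # js \<in> Z}" for n
    using i(2)[of n] by (rule pos_mono) (auto simp: Z_def)
  then have "range i \<subseteq> {i. pos k {js. i # js \<in> Z}}" by auto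
  moreover have "infinite (range i)"
    using i(1) by (simp add: range_inj_infinite strict_mono_imp_inj_on)
  ultimately have "pos (Suc k) Z" by (auto dest: finite_subset)
  moreover have "\<not> pos (Suc k) (Z - X n)" for n
  proof -
    \<comment> \<open>Column \<open>i m\<close> of \<open>Z\<close> comes from \<open>X m\<close>,
      so it lies inside \<open>X n\<close> unless \<open>m < n\<close>. The finitely many remaining
      columns are negligible whatever they contain.\<close>
    have "{j. pos k {js. j # js \<in> Z - X n}} \<subseteq> i ` {..<n}"
    proof
      fix j assume "j \<in> {j. pos k {js. j # js \<in> Z - X n}}"
      then obtain js where "j # js \<in> Z - X n" using pos_nonempty by blast
      then obtain m where "j = i m" "j # js \<in> X m" "j # js \<notin> X n" by (auto simp: Z_def)
      with mono[of n m] show "j \<in> i ` {..<n}" by (cases "n \<le> m") auto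
    qed
    then show ?thesis by (auto dest: finite_subset)
  qed
  moreover have "Z \<subseteq> X 0" using mono by (auto simp: Z_def)
  ultimately show ?thesis by blast
qed

text \<open>Every set must receive infinitely many points, so the choice runs along an enumeration
  of pairs: stage \<open>m\<close> serves the index \<open>idx m\<close> with a point not taken
  before.\<close>

lemma infinite_disjoint_refinement:
  fixes A :: "'i::countable \<Rightarrow> 'a set"
  assumes "\<And>n. n \<in> I \<Longrightarrow> infinite (A n)"
  shows "\<exists>B. (\<forall>n\<in>I. B n \<subseteq> A n \<and> infinite (B n)) \<and> (\<forall>n\<in>I. \<forall>m\<in>I. n \<noteq> m \<longrightarrow> B n \<inter> B m = {})"
proof -
  \<comment> \<open>Dropping the second component of the decoded pair makes every index occur at
    infinitely many stages.\<close>
  define idx :: "nat \<Rightarrow> 'i" where "idx m = from_nat (fst (prod_decode m))" for m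
  have "\<exists>g. \<forall>m. idx m \<in> I \<longrightarrow> g m \<in> A (idx m) - g ` {..<m}"
  proof (rule dependent_wf_choice[OF wf_less_than, of "\<lambda>g m r. idx m \<in> I \<longrightarrow> r \<in> A (idx m) - g ` {..<m}"])
    fix m and g :: "nat \<Rightarrow> 'a"
    show "\<exists>r. idx m \<in> I \<longrightarrow> r \<in> A (idx m) - g ` {..<m}"
    proof (cases "idx m \<in> I")
      case True
      then have "infinite (A (idx m) - g ` {..<m})" using assms by (simp add: Diff_infinite_finite)
      then show ?thesis by (metis ex_in_conv finite.emptyI)
    qed simp
  qed auto
  then obtain g where g: "\<And>m. idx m \<in> I \<Longrightarrow> g m \<in> A (idx m) - g ` {..<m}" by blast
  have inj: "inj_on g {m. idx m \<in> I}"
  proof (rule linorder_inj_onI)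
    fix x y assume "x < y" "y \<in> {m. idx m \<in> I}"
    with g[of y] show "g x \<noteq> g y" by (metis DiffD2 imageI lessThan_iff mem_Collect_eq)
  qed auto
  have "infinite {m. idx m = n}" for n
  proof -
    have "(\<lambda>j. prod_encode (to_nat n, j)) ` UNIV \<subseteq> {m. idx m = n}" by (auto simp: idx_def)
    moreover have "infinite ((\<lambda>j. prod_encode (to_nat n, j)) ` UNIV)"
      by (intro range_inj_infinite) (auto simp: inj_def)
    ultimately show ?thesis by (auto dest: finite_subset)
  qed
  then have "infinite (g ` {m. idx m = n})" if "n \<in> I" for n
    using that by (auto dest!: finite_imageD intro: inj_on_subset[OF inj])
  moreover have "g ` {m. idx m = n} \<inter> g ` {m. idx m = n'} = {}" if "n \<in> I" "n' \<in> I" "n \<noteq> n'" for n n'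
    using that inj by (auto dest: inj_onD)
  ultimately show ?thesis
    using g by (intro exI[of _ "\<lambda>n. g ` {m. idx m = n}"]) auto
qed

section \<open>Functions of canonical type on positive sets\<close>

definition canonical_on :: "nat \<Rightarrow> (nat list \<Rightarrow> 'a) \<Rightarrow> nat list set \<Rightarrow> bool" where
  "canonical_on l f X \<longleftrightarrow> (\<forall>x\<in>X. \<forall>y\<in>X. f x = f y \<longleftrightarrow> take l x = take l y)"

text \<open>Type 0 has to be excluded, since constant functions may share their value. For
  \<open>l = 1\<close> it suffices to thin out the sets of values; for larger \<open>l\<close> the
  induction hypothesis is applied to all columns of all \<open>X n\<close> at once, where the type
  drops to \<open>l - 1\<close>. Indices are lists so that column \<open>i\<close> of the set with
  index \<open>n\<close> again has an index, namely \<open>i # n\<close>.\<close>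

lemma canonical_disjoint_refinement:
  fixes X :: "nat list \<Rightarrow> nat list set" and f :: "nat list \<Rightarrow> nat list \<Rightarrow> 'a"
  assumes "1 \<le> l" "l \<le> k"
    and "\<And>n. n \<in> I \<Longrightarrow> pos k (X n) \<and> canonical_on l (f n) (X n)"
  shows "\<exists>Y. (\<forall>n\<in>I. Y n \<subseteq> X n \<and> pos k (Y n)) \<and>
    (\<forall>n\<in>I. \<forall>m\<in>I. n \<noteq> m \<longrightarrow> f n ` Y n \<inter> f m ` Y m = {})"
  using assms
proof (induction k arbitrary: l I X f)
  case 0
  then show ?case by simp
next
  case (Suc k)
  define A where "A n = {i. pos k {js. i # js \<in> X n}}" for n
  have infA: "infinite (A n)" if "n \<in> I" for n
    using Suc.prems(3)[OF that] by (simp add: A_def)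
  show ?case
  proof (cases "l = 1")
    case True
    \<comment> \<open>For type 1 the value of \<open>f n\<close> depends only on the column, and
      \<open>c n i\<close> reads it at a chosen point.\<close>
    define c where "c n i = f n (i # (SOME js. i # js \<in> X n))" for n i
    have some: "i # (SOME js. i # js \<in> X n) \<in> X n" if "i \<in> A n" for n i
    proof -
      have "\<exists>js. i # js \<in> X n" using that pos_nonempty by (auto simp: A_def)
      then show ?thesis by (rule someI_ex)
    qed
    have c: "f n (i # js) = c n i" if "n \<in> I" "i \<in> A n" "i # js \<in> X n" for n i js
      using Suc.prems(3)[OF that(1)] some[OF that(2)] that(3) True
      by (simp add: c_def canonical_on_def)
    have "inj_on (c n) (A n)" if "n \<in> I" for n
      using Suc.prems(3)[OF that] some True
      by (auto simp: c_def canonical_on_def inj_on_def)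
    then have "infinite (c n ` A n)" if "n \<in> I" for n
      using infA that by (auto dest: finite_imageD)
    then obtain B where B: "\<forall>n\<in>I. B n \<subseteq> c n ` A n \<and> infinite (B n)"
      "\<forall>n\<in>I. \<forall>m\<in>I. n \<noteq> m \<longrightarrow> B n \<inter> B m = {}"
      using infinite_disjoint_refinement[of I "\<lambda>n. c n ` A n"] by blast
    \<comment> \<open>A column in \<open>A n\<close> is kept or discarded as a whole, so every
      surviving one stays positive.\<close>
    define Y where "Y n = {y \<in> X n. f n y \<in> B n}" for n
    have "pos (Suc k) (Y n)" if n: "n \<in> I" for n
    proof -
      have "{i \<in> A n. c n i \<in> B n} \<subseteq> {i. pos k {js. i # js \<in> Y n}}"
      proof
        fix i assume "i \<in> {i \<in> A n. c n i \<in> B n}"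
        then have i: "i \<in> A n" "c n i \<in> B n" by auto
        then have "{js. i # js \<in> Y n} = {js. i # js \<in> X n}"
          using c[OF n] by (auto simp: Y_def)
        with i show "i \<in> {i. pos k {js. i # js \<in> Y n}}" by (simp add: A_def)
      qed
      moreover have "infinite {i \<in> A n. c n i \<in> B n}"
      proof
        assume "finite {i \<in> A n. c n i \<in> B n}"
        then have "finite (c n ` {i \<in> A n. c n i \<in> B n})" by simp
        moreover have "B n \<subseteq> c n ` {i \<in> A n. c n i \<in> B n}" using B(1) n by auto
        ultimately show False using B(1) n finite_subset by blast
      qed
      ultimately show ?thesis by (auto dest: finite_subset)
    qed
    moreover have "f n ` Y n \<inter> f m ` Y m = {}" if "n \<in> I" "m \<in> I" "n \<noteq> m" for n m
    proof -
      have "B n \<inter> B m = {}" using B(2) that by simp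
      then show ?thesis by (auto simp: Y_def)
    qed
    moreover have "Y n \<subseteq> X n" for n by (auto simp: Y_def)
    ultimately show ?thesis by (intro exI[of _ Y] conjI ballI impI)
  next
    case False
    define I' where "I' = {i # n |i n. n \<in> I \<and> i \<in> A n}"
    define X' where "X' m = {js. hd m # js \<in> X (tl m)}" for m
    define f' where "f' m js = f (tl m) (hd m # js)" for m js
    have "pos k (X' m) \<and> canonical_on (l - 1) (f' m) (X' m)" if m: "m \<in> I'" for m
    proof -
      obtain i n where n: "m = i # n" "n \<in> I" "i \<in> A n" using m by (auto simp: I'_def)
      have "f n (i # x) = f n (i # y) \<longleftrightarrow> take (l - 1) x = take (l - 1) y"
        if "i # x \<in> X n" "i # y \<in> X n" for x y
      proof -
        have "f n (i # x) = f n (i # y) \<longleftrightarrow> take l (i # x) = take l (i # y)"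
          using Suc.prems(3)[OF n(2)] that by (auto simp: canonical_on_def)
        then show ?thesis using Suc.prems(1) by (cases l) auto
      qed
      then show ?thesis using n by (auto simp: X'_def f'_def A_def canonical_on_def)
    qed
    moreover have "1 \<le> l - 1" "l - 1 \<le> k" using Suc.prems(1,2) False by auto
    ultimately obtain Y' where
      Y': "\<forall>m\<in>I'. Y' m \<subseteq> X' m \<and> pos k (Y' m)"
        "\<forall>n\<in>I'. \<forall>m\<in>I'. n \<noteq> m \<longrightarrow> f' n ` Y' n \<inter> f' m ` Y' m = {}"
      using Suc.IH[of "l - 1" I' X' f'] by blast
    define Y where "Y n = {i # js |i js. i \<in> A n \<and> js \<in> Y' (i # n)}" for n
    have I': "i # n \<in> I' \<longleftrightarrow> n \<in> I \<and> i \<in> A n" for i n by (auto simp: I'_def)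
    have sub: "Y n \<subseteq> X n" if "n \<in> I" for n
    proof
      fix y assume "y \<in> Y n"
      then obtain i js where y: "y = i # js" "i \<in> A n" "js \<in> Y' (i # n)" by (auto simp: Y_def)
      then have "js \<in> X' (i # n)" using Y'(1) I' that by blast
      then show "y \<in> X n" by (simp add: y X'_def)
    qed
    have pos: "pos (Suc k) (Y n)" if n: "n \<in> I" for n
    proof -
      have "A n \<subseteq> {i. pos k {js. i # js \<in> Y n}}"
        using Y'(1) I' n by (auto simp: Y_def)
      then show ?thesis using infA[OF n] by (auto dest: finite_subset)
    qed
    have disj: "f n ` Y n \<inter> f m ` Y m = {}" if nm: "n \<in> I" "m \<in> I" "n \<noteq> m" for n m
    proof -
      have "f n y \<noteq> f m z" if yz: "y \<in> Y n" "z \<in> Y m" for y z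
      proof -
        obtain i js where y: "y = i # js" "i \<in> A n" "js \<in> Y' (i # n)"
          using yz(1) by (auto simp: Y_def)
        obtain j ks where z: "z = j # ks" "j \<in> A m" "ks \<in> Y' (j # m)"
          using yz(2) by (auto simp: Y_def)
        have "f' (i # n) ` Y' (i # n) \<inter> f' (j # m) ` Y' (j # m) = {}"
          using Y'(2) nm I' y(2) z(2) by blast
        with y(3) z(3) have "f' (i # n) js \<noteq> f' (j # m) ks" by blast
        then show ?thesis by (simp add: f'_def y z)
      qed
      then show ?thesis by blast
    qed
    show ?thesis using sub pos disj by (intro exI[of _ Y] conjI ballI impI)
  qed
qed

text \<open>A finite range has an infinite fibre; for an infinite range one point is chosen from
  each fibre. This is canonization in one coordinate.\<close>

lemma infinite_constant_or_injective:
  assumes "infinite A"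
  shows "\<exists>B\<subseteq>A. infinite B \<and> ((\<forall>x\<in>B. \<forall>y\<in>B. c x = c y) \<or> inj_on c B)"
proof (cases "finite (c ` A)")
  case True
  then obtain x where "infinite {y \<in> A. c y = c x}"
    using pigeonhole_infinite[OF assms] by blast
  then show ?thesis by (intro exI[of _ "{y \<in> A. c y = c x}"]) auto
next
  case False
  obtain B where "B \<subseteq> A" "inj_on c B" "c ` A = c ` B"
    using subset_image_inj[of "c ` A" c A] by auto
  then show ?thesis using False by (metis finite_imageI)
qed

text \<open>There is no further type of equivalence relation: a function such as \<open>(i, j) \<mapsto> j\<close> becomes
  injective on a positive set once the columns are made disjoint.\<close>

lemma canonization:
  fixes f :: "nat list \<Rightarrow> 'a"
  assumes "pos k X"
  shows "\<exists>Y\<subseteq>X. \<exists>l\<le>k. pos k Y \<and> canonical_on l f Y"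
  using assms
proof (induction k arbitrary: X f)
  case 0
  then show ?case by (intro exI[of _ "{[]}"]) (auto simp: canonical_on_def)
next
  case (Suc k)
  define A where "A = {i. pos k {js. i # js \<in> X}}"
  have infA: "infinite A" using Suc.prems by (simp add: A_def)
  have "\<exists>Y l. Y \<subseteq> {js. i # js \<in> X} \<and> l \<le> k \<and> pos k Y \<and> canonical_on l (\<lambda>js. f (i # js)) Y"
    if "i \<in> A" for i
    using Suc.IH[of "{js. i # js \<in> X}" "\<lambda>js. f (i # js)"] that unfolding A_def by blast
  then obtain Y l where Y: "\<And>i. i \<in> A \<Longrightarrow> Y i \<subseteq> {js. i # js \<in> X} \<and> l i \<le> k \<and> pos k (Y i) \<and>
      canonical_on (l i) (\<lambda>js. f (i # js)) (Y i)"
    by metis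
  \<comment> \<open>Only finitely many types are available, so infinitely many columns share one of
    them.\<close>
  have "l ` A \<subseteq> {..k}" using Y by auto
  then obtain a where a: "a \<in> A" "infinite {i \<in> A. l i = l a}"
    using pigeonhole_infinite[OF infA, of l] finite_subset by blast
  define A' where "A' = {i \<in> A. l i = l a}"
  \<comment> \<open>What remains after \<open>glue\<close> is to choose the columns
    \<open>B\<close>, the thinned parts \<open>Y' i\<close> and the resulting type
    \<open>m\<close>.\<close>
  have glue: "\<exists>Z\<subseteq>X. \<exists>l\<le>Suc k. pos (Suc k) Z \<and> canonical_on l f Z"
    if "B \<subseteq> A" "infinite B" "\<And>i. i \<in> B \<Longrightarrow> Y' i \<subseteq> Y i \<and> pos k (Y' i)" "m \<le> Suc k"
      and can: "\<And>i j x y. i \<in> B \<Longrightarrow> j \<in> B \<Longrightarrow> x \<in> Y' i \<Longrightarrow> y \<in> Y' j \<Longrightarrow>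
        f (i # x) = f (j # y) \<longleftrightarrow> take m (i # x) = take m (j # y)"
    for B Y' m
  proof -
    let ?Z = "{i # js |i js. i \<in> B \<and> js \<in> Y' i}"
    have "?Z \<subseteq> X" using that(1,3) Y by blast
    moreover have "B \<subseteq> {i. pos k {js. i # js \<in> ?Z}}" using that(3) by auto
    then have "pos (Suc k) ?Z" using that(2) by (auto dest: finite_subset)
    moreover have "canonical_on m f ?Z" unfolding canonical_on_def using can by blast
    ultimately show ?thesis using that(4) by blast
  qed
  show ?case
  proof (cases "l a = 0")
    case True
    \<comment> \<open>Each column now has a single value \<open>c i\<close>. Equal values for all
      columns give type 0, pairwise distinct ones give type 1.\<close>
    define c where "c i = f (i # (SOME js. js \<in> Y i))" for i
    have c: "f (i # js) = c i" if "i \<in> A'" "js \<in> Y i" for i js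
    proof -
      have "i \<in> A" "l i = 0" using that True by (auto simp: A'_def)
      then have "canonical_on 0 (\<lambda>js. f (i # js)) (Y i)" using Y[of i] by simp
      moreover have "(SOME js. js \<in> Y i) \<in> Y i" using that(2) by (rule someI)
      ultimately show ?thesis
        using that(2) unfolding c_def canonical_on_def by (metis take0)
    qed
    obtain B where B: "B \<subseteq> A'" "infinite B" "(\<forall>x\<in>B. \<forall>y\<in>B. c x = c y) \<or> inj_on c B"
      using infinite_constant_or_injective[OF a(2), of c] unfolding A'_def by blast
    have BA: "B \<subseteq> A" using B(1) by (auto simp: A'_def)
    from B(3) show ?thesis
    proof
      assume "\<forall>x\<in>B. \<forall>y\<in>B. c x = c y"
      then have can: "f (i # x) = f (j # y)" if "i \<in> B" "j \<in> B" "x \<in> Y i" "y \<in> Y j" for i j x y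
        using c B(1) that by (metis subsetD)
      show ?thesis
      proof (rule glue[OF BA B(2), of Y 0])
        show "Y i \<subseteq> Y i \<and> pos k (Y i)" if "i \<in> B" for i using Y BA that by auto
      qed (auto intro: can)
    next
      assume "inj_on c B"
      then have can: "f (i # x) = f (j # y) \<longleftrightarrow> i = j" if "i \<in> B" "j \<in> B" "x \<in> Y i" "y \<in> Y j" for i j x y
        using c B(1) that by (metis inj_onD subsetD)
      show ?thesis
      proof (rule glue[OF BA B(2), of Y 1])
        show "Y i \<subseteq> Y i \<and> pos k (Y i)" if "i \<in> B" for i using Y BA that by auto
      qed (simp_all add: can)
    qed
  next
    case False
    \<comment> \<open>Once different columns have disjoint images, equal values force equal heads,
      and type \<open>l a\<close> on the columns becomes type \<open>Suc (l a)\<close> on their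
      union. The index \<open>[i]\<close> adapts the column number to the list indices of the
      refinement lemma.\<close>
    let ?I = "(\<lambda>i. [i]) ` A'"
    have "\<exists>Y'. (\<forall>n\<in>?I. Y' n \<subseteq> Y (hd n) \<and> pos k (Y' n)) \<and>
      (\<forall>n\<in>?I. \<forall>m\<in>?I. n \<noteq> m \<longrightarrow> (\<lambda>js. f (hd n # js)) ` Y' n \<inter> (\<lambda>js. f (hd m # js)) ` Y' m = {})"
    proof (rule canonical_disjoint_refinement)
      show "1 \<le> l a" "l a \<le> k" using False Y[OF a(1)] by simp_all
      show "pos k (Y (hd n)) \<and> canonical_on (l a) (\<lambda>js. f (hd n # js)) (Y (hd n))"
        if "n \<in> ?I" for n
        using that Y[of "hd n"] by (auto simp: A'_def)
    qed
    then obtain Y' where Y': "\<forall>n\<in>?I. Y' n \<subseteq> Y (hd n) \<and> pos k (Y' n)"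
      "\<forall>n\<in>?I. \<forall>m\<in>?I. n \<noteq> m \<longrightarrow> (\<lambda>js. f (hd n # js)) ` Y' n \<inter> (\<lambda>js. f (hd m # js)) ` Y' m = {}"
      by (elim exE conjE) (rule that)
    show ?thesis
    proof (rule glue[of A' "\<lambda>i. Y' [i]" "Suc (l a)"])
      show "A' \<subseteq> A" "infinite A'" using a(2) by (auto simp: A'_def)
      show "Y' [i] \<subseteq> Y i \<and> pos k (Y' [i])" if "i \<in> A'" for i using Y'(1) that by auto
      show "Suc (l a) \<le> Suc k" using Y[OF a(1)] by simp
      fix i j x y assume h: "i \<in> A'" "j \<in> A'" "x \<in> Y' [i]" "y \<in> Y' [j]"
      show "f (i # x) = f (j # y) \<longleftrightarrow> take (Suc (l a)) (i # x) = take (Suc (l a)) (j # y)"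
      proof (cases "i = j")
        case True
        have "x \<in> Y i" "y \<in> Y i" "i \<in> A" "l i = l a" using h Y'(1) True by (auto simp: A'_def)
        moreover from this have "canonical_on (l a) (\<lambda>js. f (i # js)) (Y i)" using Y[of i] by simp
        ultimately show ?thesis using True by (simp add: canonical_on_def)
      next
        case False
        then have "(\<lambda>js. f (i # js)) ` Y' [i] \<inter> (\<lambda>js. f (j # js)) ` Y' [j] = {}"
          using Y'(2) h(1,2) by force
        then have "f (i # x) \<noteq> f (j # y)" using h(3,4) by blast
        then show ?thesis using False by auto
      qed
    qed
  qed
qed

section \<open>Trees in \<open>\<E>\<^sub>k\<close>\<close>

lemma take_in_nd_le: "js \<in> nd_le k \<Longrightarrow> take q js \<in> nd_le k"
  by (auto simp: nd_le_def sorted_wrt_take)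

lemma prec_irrefl: "\<not> prec js js"
  by (auto simp: prec_def lexord_irreflexive)

lemma prec_trans: "prec js ks \<Longrightarrow> prec ks ls \<Longrightarrow> prec js ls"
  unfolding prec_def using lexord_trans[OF _ _ trans_less_than] by auto

lemma prec_total: "js \<noteq> ls \<Longrightarrow> prec js ls \<or> prec ls js"
  unfolding prec_def using lexord_linear[of less_than js ls] less_linear
  by (auto simp: not_less_iff_gr_or_eq)

lemma sorted_le_last: "sorted xs \<Longrightarrow> x \<in> set xs \<Longrightarrow> x \<le> last xs"
  for xs :: "nat list"
  by (cases xs rule: rev_cases) (auto simp: sorted_append)

lemma last_le_last_if_prefix:
  fixes js ls :: "nat list"
  assumes "prefix js ls" "sorted ls" "js \<noteq> []"
  shows "last js \<le> last ls"
proof -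
  obtain zs where "ls = js @ zs" using assms(1) by (auto simp: prefix_def)
  then show ?thesis using assms(2,3) by (cases "zs = []") (auto simp: sorted_append)
qed

text \<open>Monotonicity is the reason: the last entry of an initial segment is not larger, and in a
  tie the lexicographic clause decides.\<close>

lemma strict_prefix_imp_prec:
  assumes "strict_prefix js ls" "ls \<in> nd_le k"
  shows "prec js ls"
proof -
  obtain b zs where "ls = js @ b # zs" using assms(1) by (rule strict_prefixE')
  moreover from this have "(js, ls) \<in> lexord less_than" by (auto intro: lexord_append_rightI)
  moreover have "js \<noteq> [] \<Longrightarrow> last js \<le> last ls"
    using assms last_le_last_if_prefix by (auto simp: nd_le_def)
  ultimately show ?thesis by (auto simp: prec_def)
qed

text \<open>A predecessor is sorted with last entry at most \<open>last ls\<close>, hence a list of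
  bounded length over a finite set. So counting predecessors gives positions in the
  well-order.\<close>

lemma finite_prec: "finite {js \<in> nd_le k. prec js ls}"
proof (rule finite_subset)
  show "{js \<in> nd_le k. prec js ls} \<subseteq> {js. set js \<subseteq> {..last ls} \<and> length js \<le> k}"
  proof (clarsimp simp: nd_le_def)
    fix js x assume h: "prec js ls" "sorted js" "x \<in> set js"
    then have "js \<noteq> []" by auto
    have "x \<le> last js" using h sorted_le_last by blast
    with h(1) \<open>js \<noteq> []\<close> show "x \<le> last ls" by (auto simp: prec_def)
  qed
qed (simp add: finite_lists_length_le)

lemma nd_index_less: "prec js ls \<Longrightarrow> js \<in> nd_le k \<Longrightarrow> nd_index k js < nd_index k ls"
  unfolding nd_index_def using prec_irrefl prec_trans
  by (intro psubset_card_mono finite_prec) blast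

lemma nd_index_less_iff:
  "js \<in> nd_le k \<Longrightarrow> ls \<in> nd_le k \<Longrightarrow> nd_index k js < nd_index k ls \<longleftrightarrow> prec js ls"
  using nd_index_less prec_total by (metis less_asym less_irrefl)

lemma inj_on_nd_index: "inj_on (nd_index k) (nd_le k)"
  using nd_index_less prec_total by (metis inj_onI less_irrefl)

lemma nd_nth_nd_index: "js \<in> nd_le k \<Longrightarrow> nd_nth k (nd_index k js) = js"
  unfolding nd_nth_def using inj_on_nd_index by (intro the_equality) (auto dest: inj_onD)

text \<open>There are no gaps below an attained index, because the largest predecessor
  \<open>b\<close> of \<open>js\<close> has exactly one predecessor fewer than
  \<open>js\<close>.\<close>

lemma nd_index_downward:
  assumes "js \<in> nd_le k" "m \<le> nd_index k js"
  shows "\<exists>ls\<in>nd_le k. nd_index k ls = m"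
  using assms
proof (induction "nd_index k js" arbitrary: js)
  case 0
  then show ?case by auto
next
  case (Suc n)
  let ?P = "{ls \<in> nd_le k. prec ls js}"
  show ?case
  proof (cases "m = Suc n")
    case True
    with Suc show ?thesis by auto
  next
    case False
    have "?P \<noteq> {}" using Suc.hyps(2) unfolding nd_index_def by (metis card.empty nat.distinct(1))
    then obtain b where b: "b \<in> ?P" "\<And>c. c \<in> ?P \<Longrightarrow> nd_index k c \<le> nd_index k b"
      using Max_in[of "nd_index k ` ?P"] Max_ge[of "nd_index k ` ?P"] finite_prec[of k js]
      by (smt (verit, best) finite_imageI image_iff image_is_empty)
    have "?P = insert b {ls \<in> nd_le k. prec ls b}"
    proof (intro equalityI subsetI)
      fix c assume c: "c \<in> ?P"
      then show "c \<in> insert b {ls \<in> nd_le k. prec ls b}"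
        using b prec_total nd_index_less by (metis (no_types, lifting) insertI1 insertI2 leD mem_Collect_eq)
    qed (use b prec_trans in auto)
    then have "nd_index k js = Suc (nd_index k b)"
      using finite_prec[of k b] prec_irrefl unfolding nd_index_def by simp
    then show ?thesis using Suc b(1) False by simp
  qed
qed

lemma nd_index_surj:
  assumes "1 \<le> k"
  shows "\<exists>js\<in>nd_le k. nd_index k js = m"
proof -
  have "range (\<lambda>i. [i]) \<subseteq> nd_le k" using assms by (auto simp: nd_le_def)
  moreover have "infinite (range (\<lambda>i::nat. [i]))" by (intro range_inj_infinite) (auto simp: inj_def)
  ultimately have "infinite (nd_index k ` nd_le k)"
    using inj_on_nd_index by (metis finite_imageD finite_subset)
  then obtain n where "m \<le> n" "n \<in> nd_index k ` nd_le k"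
    by (metis infinite_nat_iff_unbounded_le)
  then show ?thesis using nd_index_downward by blast
qed

lemma nd_nth_in_nd_le: "1 \<le> k \<Longrightarrow> nd_nth k m \<in> nd_le k"
  using nd_index_surj nd_nth_nd_index by metis

lemma nd_index_nd_nth: "1 \<le> k \<Longrightarrow> nd_index k (nd_nth k m) = m"
  using nd_index_surj nd_nth_nd_index by metis

text \<open>The increasing enumeration of \<open>W_of k js\<close>, see
  \<open>sorted_list_of_W_of\<close>. As a list it commutes with \<open>take\<close>, so initial
  segments of sequences become initial segments of codes.\<close>

definition code :: "nat \<Rightarrow> nat list \<Rightarrow> nat list" where
  "code k js = map (\<lambda>q. nd_index k (take (Suc q) js)) [0..<length js]"

lemma length_code [simp]: "length (code k js) = length js"
  by (simp add: code_def)

lemma sorted_code: "js \<in> nd_le k \<Longrightarrow> sorted_wrt (<) (code k js)"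
proof -
  assume js: "js \<in> nd_le k"
  have "nd_index k (take (Suc i) js) < nd_index k (take (Suc j) js)" if "i < j" "j < length js" for i j
  proof (rule nd_index_less)
    have "take (Suc i) js = take (Suc i) (take (Suc j) js)" using that by (simp add: min_def)
    then have "prefix (take (Suc i) js) (take (Suc j) js)" by (metis take_is_prefix)
    moreover have "length (take (Suc i) js) < length (take (Suc j) js)" using that by simp
    ultimately show "prec (take (Suc i) js) (take (Suc j) js)"
      using js take_in_nd_le strict_prefix_imp_prec by (metis less_irrefl strict_prefix_def)
  qed (use js take_in_nd_le in auto)
  then show ?thesis by (simp add: code_def sorted_wrt_iff_nth_less)
qed

lemma set_code: "set (code k js) = W_of k js"
proof -
  have "W_of k js = (\<lambda>q. nd_index k (take q js)) ` (Suc ` {0..<length js})"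
    by (auto simp: W_of_def image_Suc_atLeastLessThan)
  then show ?thesis by (simp only: code_def set_map set_upt image_image)
qed

lemma take_code: "take q (code k js) = code k (take q js)"
  by (rule nth_equalityI) (simp_all add: code_def min.absorb1 Suc_leI)

lemma sorted_list_of_W_of: "js \<in> nd_le k \<Longrightarrow> sorted_list_of_set (W_of k js) = code k js"
  using sorted_code[of js k] set_code[of k js]
  by (metis sorted_list_of_set.idem_if_sorted_distinct strict_sorted_iff)

lemma card_W_of: "js \<in> nd_le k \<Longrightarrow> card (W_of k js) = length js"
  by (metis length_code length_sorted_list_of_set sorted_list_of_W_of)

lemma nd_eq_subset_nd_le: "nd_eq k \<subseteq> nd_le k"
  by (auto simp: nd_eq_def nd_le_def)

lemma W_set_iff: "w \<in> W_set k \<longleftrightarrow> w \<in> W_hat k \<and> card w = k"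
proof
  show "w \<in> W_hat k \<and> card w = k" if w: "w \<in> W_set k"
  proof -
    obtain js where js: "js \<in> nd_eq k" "w = W_of k js" using w by (auto simp: W_set_def)
    moreover from this have "js \<in> nd_le k" using nd_eq_subset_nd_le by blast
    ultimately show ?thesis using card_W_of by (auto simp: W_hat_def nd_eq_def)
  qed
  show "w \<in> W_set k" if w: "w \<in> W_hat k \<and> card w = k"
  proof -
    obtain js where js: "js \<in> nd_le k" "w = W_of k js" using w by (auto simp: W_hat_def)
    then have "js \<in> nd_eq k" using w card_W_of by (auto simp: nd_eq_def nd_le_def)
    then show ?thesis using js by (auto simp: W_set_def)
  qed
qed

definition code_set :: "nat \<Rightarrow> nat list set" where
  "code_set k = sorted_list_of_set ` W_set k"

lemma code_set_eq: "code_set k = code k ` nd_eq k"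
proof -
  have "sorted_list_of_set (W_of k js) = code k js" if "js \<in> nd_eq k" for js
    using that nd_eq_subset_nd_le by (blast intro: sorted_list_of_W_of)
  then show ?thesis unfolding code_set_def W_set_def image_image by (rule image_cong[OF refl])
qed

lemma code_set_subset: "code_set k \<subseteq> omega_pow k"
  by (auto simp: code_set_eq omega_pow_def nd_eq_def)

text \<open>The ground model form of an E_k-tree, with finite sets replaced by their increasing
  enumerations: \<open>last\<close> plays the role of the maximum, and commuting with
  \<open>take\<close> encodes the initial segment clause. Excluding \<open>ls = []\<close>
  corresponds to comparing maxima only from index 1 on, index 0 being the empty sequence.\<close>

definition tree_embedding :: "nat \<Rightarrow> (nat list \<Rightarrow> nat list) \<Rightarrow> bool" where
  "tree_embedding k E \<longleftrightarrow> (\<forall>js\<in>nd_le k. set (E js) \<in> W_hat k \<and> sorted_wrt (<) (E js) \<and>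
     length (E js) = length js \<and> (\<forall>q. E (take q js) = take q (E js)) \<and>
     (\<forall>ls\<in>nd_le k. ls \<noteq> [] \<longrightarrow> prec ls js \<longrightarrow> last (E ls) < last (E js)))"

lemma tree_embedding_inj:
  assumes "tree_embedding k E"
  shows "inj_on E (nd_le k)"
proof (rule inj_onI, rule ccontr)
  fix js ls assume h: "js \<in> nd_le k" "ls \<in> nd_le k" "E js = E ls" "js \<noteq> ls"
  then have len: "length js = length ls" using assms by (metis tree_embedding_def)
  then have "js \<noteq> []" "ls \<noteq> []" using h(4) by auto
  with h prec_total[OF h(4)] show False using assms by (metis tree_embedding_def less_irrefl)
qed

lemma positive_tree_embedding:
  assumes k: "1 \<le> k" and X: "X \<subseteq> code_set k" and pos: "pos k X"
  shows "\<exists>E. tree_embedding k E \<and> E ` nd_eq k \<subseteq> X \<and> pos k (E ` nd_eq k)"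
proof -
  \<comment> \<open>\<open>U\<close> is the tree of nodes above which \<open>X\<close> is positive; each of its inner nodes has infinitely many
    successors, so \<open>E\<close> can be chosen along \<open>prec\<close> with each new last entry above all earlier ones.\<close>
  define U where "U s \<longleftrightarrow> length s \<le> k \<and> pos (k - length s) {t. s @ t \<in> X}" for s
  have U_Nil: "U []" using pos by (simp add: U_def)
  have U_succ: "infinite {i. U (s @ [i])}" if s: "U s" "length s < k" for s
  proof -
    obtain d where d: "k - length s = Suc d" using s(2) by (metis Suc_diff_Suc)
    then have "k - Suc (length s) = d" by simp
    with s d show ?thesis by (simp add: U_def)
  qed
  \<comment> \<open>Because \<open>X\<close> consists of codes, every node of \<open>U\<close> is
    the code of an initial segment. This will put the values of \<open>E\<close> into
    \<open>W_hat k\<close>.\<close>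
  have U_code: "\<exists>js\<in>nd_le k. s = code k js" if "U s" for s
  proof -
    obtain t where "s @ t \<in> X" using \<open>U s\<close> pos_nonempty unfolding U_def by blast
    then obtain js where js: "js \<in> nd_eq k" "s @ t = code k js" using X code_set_eq by auto
    then have "s = code k (take (length s) js)" by (metis append_eq_conv_conj take_code)
    then show ?thesis using js(1) nd_eq_subset_nd_le take_in_nd_le by blast
  qed
  \<comment> \<open>\<open>ok E js r\<close> means that \<open>r\<close> is an admissible value at
    \<open>js\<close>, given the values of \<open>E\<close> at earlier sequences. It is void outside
    \<open>nd_le k\<close>, so that the recursion may define a total function.\<close>
  define ok where "ok E js r \<longleftrightarrow> (js \<in> nd_le k \<longrightarrow> U r \<and> length r = length js \<and>
      (js \<noteq> [] \<longrightarrow> butlast r = E (butlast js) \<and>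
        (\<forall>ls\<in>nd_le k. ls \<noteq> [] \<longrightarrow> prec ls js \<longrightarrow> last (E ls) < last r)))"
    for E :: "nat list \<Rightarrow> nat list" and js r
  define Rel where "Rel = {(ls, js). ls \<in> nd_le k \<and> js \<in> nd_le k \<and> prec ls js}"
  have Rel_butlast: "(butlast js, js) \<in> Rel" if "js \<in> nd_le k" "js \<noteq> []" for js
  proof -
    have "strict_prefix (butlast js) js"
      using that(2) by (metis append_butlast_last_id strict_prefixI')
    then show ?thesis
      using that strict_prefix_imp_prec take_in_nd_le by (auto simp: Rel_def butlast_conv_take)
  qed
  have "\<exists>E. \<forall>js. ok E js (E js)"
  proof (rule dependent_wf_choice[of Rel ok])
    show "wf Rel"
      by (rule wf_subset[OF wf_measure[of "nd_index k"]]) (auto simp: Rel_def nd_index_less)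
    show "ok f js r = ok g js r" if "\<And>z. (z, js) \<in> Rel \<Longrightarrow> f z = g z" for f g js r
    proof (cases "js \<in> nd_le k")
      case True
      then have "js \<noteq> [] \<Longrightarrow> f (butlast js) = g (butlast js)"
        "\<forall>ls\<in>nd_le k. prec ls js \<longrightarrow> f ls = g ls"
        using that Rel_butlast by (auto simp: Rel_def)
      then show ?thesis unfolding ok_def by (metis (no_types, lifting))
    qed (simp add: ok_def)
    show "\<exists>r. ok E js r" if IH: "\<And>ls. (ls, js) \<in> Rel \<Longrightarrow> ok E ls (E ls)" for js E
    proof (cases "js \<in> nd_le k \<and> js \<noteq> []")
      case True
      let ?s = "E (butlast js)"
      have b: "butlast js \<in> nd_le k" using True take_in_nd_le by (auto simp: butlast_conv_take)
      have "ok E (butlast js) ?s" using IH Rel_butlast True by blast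
      then have s: "U ?s" "length ?s = length js - 1" using b by (auto simp: ok_def)
      have "length ?s < k" using s(2) True by (cases js) (auto simp: nd_le_def)
      then have inf: "infinite {i. U (?s @ [i])}" using s(1) U_succ by blast
      \<comment> \<open>Only finitely many sequences come earlier, whereas the node has infinitely
        many successors; hence some successor exceeds all earlier last entries.\<close>
      define F where "F = (\<lambda>ls. last (E ls)) ` {ls \<in> nd_le k. prec ls js}"
      have "finite F" unfolding F_def using finite_prec by blast
      then obtain N where N: "\<forall>x\<in>F. x \<le> N" using finite_nat_set_iff_bounded_le by blast
      obtain i where i: "i > N" "U (?s @ [i])"
        using inf by (metis (lifting) infinite_nat_iff_unbounded mem_Collect_eq)
      have "ok E js (?s @ [i])"
        unfolding ok_def using i N s True by (force simp: F_def)
      then show ?thesis by blast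
    next
      case False
      then show ?thesis using U_Nil by (intro exI[of _ "[]"]) (auto simp: ok_def)
    qed
  qed
  then obtain E where E: "\<And>js. ok E js (E js)" by blast
  have EU: "U (E js)" "length (E js) = length js" if "js \<in> nd_le k" for js
    using E[of js] that by (auto simp: ok_def)
  have E_snoc: "E js = butlast (E (js @ [a]))" if "js @ [a] \<in> nd_le k" for js a
    using E[of "js @ [a]"] that by (auto simp: ok_def)
  have E_take: "E (take q js) = take q (E js)" if "js \<in> nd_le k" for js q
    using that
  proof (induction js rule: rev_induct)
    case Nil
    then show ?case using EU[of "[]"] by simp
  next
    case (snoc a js)
    have js: "js \<in> nd_le k" using take_in_nd_le[OF snoc.prems, of "length js"] by simp
    have len: "length (E (js @ [a])) = Suc (length js)" using EU snoc.prems by simp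
    show ?case
    proof (cases "q \<le> length js")
      case True
      have "E (take q (js @ [a])) = take q (butlast (E (js @ [a])))"
        using True snoc.IH[OF js] E_snoc[OF snoc.prems] by simp
      then show ?thesis using True len by (simp add: take_butlast)
    next
      case False
      then show ?thesis using len by simp
    qed
  qed
  have E_last: "last (E ls) < last (E js)" if "js \<in> nd_le k" "ls \<in> nd_le k" "ls \<noteq> []" "prec ls js" for js ls
    using E[of js] that by (auto simp: ok_def prec_def)
  have emb: "tree_embedding k E"
    unfolding tree_embedding_def
  proof (intro ballI conjI allI impI)
    fix js assume js: "js \<in> nd_le k"
    obtain is' where "is' \<in> nd_le k" "E js = code k is'" using U_code EU js by blast
    then show "set (E js) \<in> W_hat k" "sorted_wrt (<) (E js)"
      using set_code sorted_code by (auto simp: W_hat_def)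
  qed (use EU E_take E_last in auto)
  have sub: "E ` nd_eq k \<subseteq> X"
  proof
    fix x assume "x \<in> E ` nd_eq k"
    then obtain js where js: "js \<in> nd_eq k" "x = E js" by blast
    then have "length x = k" "U x" using EU nd_eq_subset_nd_le by (auto simp: nd_eq_def)
    then show "x \<in> X" by (auto simp: U_def)
  qed
  \<comment> \<open>Positivity is verified from the leaves towards the root; \<open>d\<close> counts
    the levels still missing above \<open>js\<close>.\<close>
  have "pos d {t. E js @ t \<in> E ` nd_eq k}" if "js \<in> nd_le k" "length js + d = k" for js d
    using that
  proof (induction d arbitrary: js)
    case 0
    then have "js \<in> nd_eq k" by (auto simp: nd_le_def nd_eq_def)
    then show ?case by simp
  next
    case (Suc d)
    \<comment> \<open>The least entry that can be appended to \<open>js\<close> while keeping it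
      sorted. Distinct appended entries yield distinct successors \<open>g a\<close>, as
      \<open>E\<close> is injective, so there are infinitely many.\<close>
    define b where "b = (if js = [] then 0 else last js)"
    have ext: "js @ [a] \<in> nd_le k" if "b \<le> a" for a
    proof -
      have "x \<le> a" if "x \<in> set js" for x
      proof -
        have "x \<le> last js" using that Suc.prems sorted_le_last by (auto simp: nd_le_def)
        then show ?thesis using \<open>b \<le> a\<close> that by (auto simp: b_def split: if_splits)
      qed
      then show ?thesis using Suc.prems by (auto simp: nd_le_def sorted_append)
    qed
    define g where "g a = last (E (js @ [a]))" for a
    have g: "E (js @ [a]) = E js @ [g a]" if "b \<le> a" for a
    proof -
      have "E (js @ [a]) \<noteq> []" using EU(2)[OF ext[OF that]] by auto
      then show ?thesis using E_snoc[OF ext[OF that]] by (simp add: g_def)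
    qed
    have "inj_on g {b..}"
    proof (rule inj_onI)
      fix x y assume xy: "x \<in> {b..}" "y \<in> {b..}" "g x = g y"
      then have "E (js @ [x]) = E (js @ [y])" using g by simp
      then have "js @ [x] = js @ [y]"
        using tree_embedding_inj[OF emb] ext xy(1,2) by (auto dest: inj_onD)
      then show "x = y" by simp
    qed
    then have "infinite (g ` {b..})" using infinite_Ici by (metis finite_imageD)
    moreover have "g ` {b..} \<subseteq> {i. pos d {t. i # t \<in> {t. E js @ t \<in> E ` nd_eq k}}}"
    proof safe
      fix a assume a: "b \<le> a"
      have "pos d {t. E (js @ [a]) @ t \<in> E ` nd_eq k}" using Suc ext[OF a] by simp
      then show "pos d {t. g a # t \<in> {t. E js @ t \<in> E ` nd_eq k}}" using g[OF a] by simp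
    qed
    ultimately show ?case by (auto dest: finite_subset)
  qed
  from this[of "[]" k] have "pos k (E ` nd_eq k)" using EU[of "[]"] by (simp add: nd_le_def)
  then show ?thesis using emb sub by blast
qed

section \<open>From increasing lists back to finite sets\<close>

lemma Max_strict_sorted:
  fixes xs :: "nat list"
  assumes "sorted_wrt (<) xs" "xs \<noteq> []"
  shows "Max (set xs) = last xs"
proof (rule Max_eqI)
  have "sorted xs" using assms(1) by (simp add: strict_sorted_iff)
  then show "y \<le> last xs" if "y \<in> set xs" for y using that by (rule sorted_le_last)
qed (use assms(2) in auto)

text \<open>Strictly increasing lists with the same elements are equal. An initial segment lies
  below the remaining elements \<open>zs\<close>, so appending these to \<open>xs\<close> must give
  \<open>ys\<close>.\<close>

lemma proper_init_seg_iff_strict_prefix: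
  assumes "sorted_wrt (<) xs" "sorted_wrt (<) ys"
  shows "proper_init_seg (set xs) (set ys) \<longleftrightarrow> strict_prefix xs ys"
proof
  assume h: "proper_init_seg (set xs) (set ys)"
  define zs where "zs = filter (\<lambda>y. y \<notin> set xs) ys"
  have "sorted_wrt (<) (xs @ zs)"
  proof (subst sorted_wrt_append, intro conjI ballI)
    show "x < z" if "x \<in> set xs" "z \<in> set zs" for x z
      using h that by (auto simp: proper_init_seg_def zs_def not_le[symmetric])
  qed (use assms in \<open>auto simp: zs_def sorted_wrt_filter\<close>)
  moreover have "set (xs @ zs) = set ys" using h by (auto simp: zs_def proper_init_seg_def)
  ultimately have "ys = xs @ zs" using assms(2) by (metis strict_sorted_equal)
  then show "strict_prefix xs ys" using h by (auto simp: strict_prefix_def proper_init_seg_def)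
next
  assume "strict_prefix xs ys"
  then obtain b zs where ys: "ys = xs @ b # zs" by (rule strict_prefixE')
  then have less: "\<forall>x\<in>set xs. \<forall>y\<in>set (b # zs). x < y"
    using assms(2) by (simp add: sorted_wrt_append)
  then have "b \<notin> set xs" by auto
  then show "proper_init_seg (set xs) (set ys)"
    unfolding ys proper_init_seg_def
  proof (intro conjI ballI impI)
    show "y \<in> set xs" if "x \<in> set xs" "y \<in> set (xs @ b # zs)" "y \<le> x" for x y
      using less that by (metis Un_iff leD set_append)
  qed auto
qed

text \<open>Commuting with \<open>take\<close> carries initial segments forwards; injectivity
  carries them back.\<close>

lemma tree_embedding_strict_prefix_iff:
  assumes E: "tree_embedding k E" and js: "js \<in> nd_le k" and ls: "ls \<in> nd_le k"
  shows "strict_prefix (E js) (E ls) \<longleftrightarrow> strict_prefix js ls"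
proof
  assume h: "strict_prefix (E js) (E ls)"
  then have "E js = take (length (E js)) (E ls)" by (auto simp: strict_prefix_def prefix_def)
  also have "\<dots> = E (take (length js) ls)" using E js ls by (auto simp: tree_embedding_def)
  finally have "js = take (length js) ls"
    using tree_embedding_inj[OF E] js ls take_in_nd_le by (auto dest: inj_onD)
  then have "prefix js ls" by (metis take_is_prefix)
  then show "strict_prefix js ls" using h by (auto simp: strict_prefix_def)
next
  assume h: "strict_prefix js ls"
  then have "E js = take (length js) (E ls)"
    using E ls unfolding tree_embedding_def
    by (metis append_eq_conv_conj prefixE strict_prefix_def)
  then have "prefix (E js) (E ls)" by (metis take_is_prefix)
  moreover have "length (E js) < length (E ls)"
    using prefix_length_less[OF h] E js ls by (auto simp: tree_embedding_def)
  ultimately show "strict_prefix (E js) (E ls)" by (auto simp: strict_prefix_def)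
qed

section \<open>Calculus of the forcing relation\<close>

locale forcing =
  fixes R :: "'p rel"
  assumes refl: "p \<in> Field R \<Longrightarrow> (p, p) \<in> R"
    and trans: "(r, q) \<in> R \<Longrightarrow> (q, p) \<in> R \<Longrightarrow> (r, p) \<in> R"
begin

text \<open>Regular open sets of conditions serve as truth values. Disjunction, implication and
  existence are classical abbreviations, and the density clause supplies the double negation
  elimination needed to use them as ordinary connectives.\<close>

definition regular :: "'p set \<Rightarrow> bool" where
  "regular \<phi> \<longleftrightarrow> (\<forall>p q. p \<in> \<phi> \<longrightarrow> (q, p) \<in> R \<longrightarrow> q \<in> \<phi>) \<and>
     (\<forall>p\<in>Field R. (\<forall>q. (q, p) \<in> R \<longrightarrow> (\<exists>r. (r, q) \<in> R \<and> r \<in> \<phi>)) \<longrightarrow> p \<in> \<phi>)"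

lemma regularI:
  assumes "\<And>p q. p \<in> \<phi> \<Longrightarrow> (q, p) \<in> R \<Longrightarrow> q \<in> \<phi>"
    and "\<And>p. p \<in> Field R \<Longrightarrow> (\<And>q. (q, p) \<in> R \<Longrightarrow> \<exists>r. (r, q) \<in> R \<and> r \<in> \<phi>) \<Longrightarrow> p \<in> \<phi>"
  shows "regular \<phi>"
  unfolding regular_def using assms by metis

lemma regularD: "regular \<phi> \<Longrightarrow> p \<in> \<phi> \<Longrightarrow> (q, p) \<in> R \<Longrightarrow> q \<in> \<phi>"
  unfolding regular_def by blast

lemma regular_dense:
  assumes "regular \<phi>" "p \<in> Field R" "\<And>q. (q, p) \<in> R \<Longrightarrow> \<exists>r. (r, q) \<in> R \<and> r \<in> \<phi>"
  shows "p \<in> \<phi>"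
  using assms unfolding regular_def by blast

lemma regular_fneg: "regular \<phi> \<Longrightarrow> regular (\<^bold>\<not>\<^bsub>R\<^esub> \<phi>)"
  unfolding regular_def fneg_def by (smt (verit) mem_Collect_eq refl FieldI1 trans)

lemma regular_fand: "regular \<phi> \<Longrightarrow> regular \<psi> \<Longrightarrow> regular (\<phi> \<^bold>\<and> \<psi>)"
  unfolding regular_def fand_def by blast

lemma regular_fall: "(\<And>x. regular (\<phi> x)) \<Longrightarrow> regular (\<^bold>\<forall>x. \<phi> x)"
  unfolding regular_def fall_def by (smt (verit) mem_Collect_eq)

lemma regular_gnd: "regular (gnd b)"
  unfolding regular_def gnd_def by (auto dest: refl)

lemma regular_fmem: "regular (fmem R x \<tau>)"
proof (rule regularI)
  show "q \<in> fmem R x \<tau>" if "p \<in> fmem R x \<tau>" "(q, p) \<in> R" for p q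
    using that trans unfolding fmem_def by blast
  fix p assume dense: "\<And>q. (q, p) \<in> R \<Longrightarrow> \<exists>r. (r, q) \<in> R \<and> r \<in> fmem R x \<tau>"
  have "\<exists>s r. (s, q) \<in> R \<and> (s, r) \<in> R \<and> (r, x) \<in> \<tau>" if q: "(q, p) \<in> R" for q
  proof -
    obtain r where r: "(r, q) \<in> R" "r \<in> fmem R x \<tau>" using dense q by blast
    then show ?thesis using refl[OF FieldI1[OF r(1)]] trans unfolding fmem_def by blast
  qed
  then show "p \<in> fmem R x \<tau>" unfolding fmem_def by blast
qed

lemma regular_fimp: "regular \<phi> \<Longrightarrow> regular \<psi> \<Longrightarrow> regular (\<phi> \<^bold>\<longrightarrow>\<^bsub>R\<^esub> \<psi>)"
  unfolding fimp_def by (intro regular_fneg regular_fand)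

lemma regular_fiff: "regular \<phi> \<Longrightarrow> regular \<psi> \<Longrightarrow> regular (\<phi> \<^bold>\<longleftrightarrow>\<^bsub>R\<^esub> \<psi>)"
  unfolding fiff_def by (intro regular_fand regular_fimp)

lemma regular_fex: "(\<And>x. regular (\<phi> x)) \<Longrightarrow> regular (fex R \<phi>)"
  unfolding fex_def by (intro regular_fneg regular_fall)

lemma regular_fsub: "regular (fsub R \<sigma> \<tau>)"
  unfolding fsub_def by (intro regular_fall regular_fimp regular_fmem)

lemma regular_feq: "regular (feq R \<sigma> \<tau>)"
  unfolding feq_def by (intro regular_fall regular_fiff regular_fmem)

lemma regular_fmem2: "regular (fmem2 R F \<tau>)"
proof (rule regularI)
  show "q \<in> fmem2 R F \<tau>" if "p \<in> fmem2 R F \<tau>" "(q, p) \<in> R" for p q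
    using that trans unfolding fmem2_def by blast
  fix p assume dense: "\<And>q. (q, p) \<in> R \<Longrightarrow> \<exists>r. (r, q) \<in> R \<and> r \<in> fmem2 R F \<tau>"
  have "\<exists>s r \<sigma>. (s, q) \<in> R \<and> (s, r) \<in> R \<and> (r, \<sigma>) \<in> F \<and> s \<in> feq R \<tau> \<sigma>" if q: "(q, p) \<in> R" for q
  proof -
    obtain r where r: "(r, q) \<in> R" "r \<in> fmem2 R F \<tau>" using dense q by blast
    then show ?thesis using refl[OF FieldI1[OF r(1)]] trans unfolding fmem2_def by blast
  qed
  then show "p \<in> fmem2 R F \<tau>" unfolding fmem2_def by blast
qed

lemma regular_is_function: "regular (is_function R S T h)"
  unfolding is_function_def
  by (intro regular_fand regular_fall regular_fimp regular_fex regular_fmem regular_gnd regular_fsub)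

lemma regular_is_filter_on: "(\<And>A. regular (F A)) \<Longrightarrow> regular (is_filter_on R S F)"
  unfolding is_filter_on_def
  by (intro regular_fand regular_fall regular_fimp regular_fneg regular_fiff regular_fmem regular_fsub)

lemma regular_filter_gen: "(\<And>A. regular (B A)) \<Longrightarrow> regular (filter_gen R S B A)"
  unfolding filter_gen_def
  by (intro regular_fand regular_fall regular_fimp regular_is_filter_on regular_fmem2 regular_fsub)

lemma regular_in_E: "regular (in_E R k X)"
  unfolding in_E_def is_E_tree_def
  by (intro regular_fand regular_fall regular_fimp regular_fiff regular_fex regular_fmem
      regular_gnd regular_is_function)

lemmas regular_intros = regular_fneg regular_fand regular_fall regular_fimp regular_fiff regular_fex
  regular_gnd regular_fmem regular_fmem2 regular_fsub regular_feq regular_is_function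

lemma fand_iff: "p \<in> (\<phi> \<^bold>\<and> \<psi>) \<longleftrightarrow> p \<in> \<phi> \<and> p \<in> \<psi>"
  by (simp add: fand_def)

lemma fall_iff: "p \<in> (\<^bold>\<forall>x. \<phi> x) \<longleftrightarrow> (\<forall>x. p \<in> \<phi> x)"
  by (simp add: fall_def)

lemma gnd_iff: "p \<in> gnd b \<longleftrightarrow> b"
  by (simp add: gnd_def)

lemma fneg_iff: "p \<in> (\<^bold>\<not>\<^bsub>R\<^esub> \<phi>) \<longleftrightarrow> (\<forall>q. (q, p) \<in> R \<longrightarrow> q \<notin> \<phi>)"
  by (simp add: fneg_def)

lemma fex_iff: "p \<in> fex R \<phi> \<longleftrightarrow> (\<forall>q. (q, p) \<in> R \<longrightarrow> (\<exists>r x. (r, q) \<in> R \<and> r \<in> \<phi> x))"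
  unfolding fex_def fneg_def fall_def by blast

lemma fexI:
  assumes "\<And>x. regular (\<phi> x)" "p \<in> \<phi> x"
  shows "p \<in> fex R \<phi>"
  unfolding fex_iff using assms refl regularD by (metis FieldI1)

text \<open>Existence is negated universality, so being forced means having witnesses densely often.
  A specific witness appears only after strengthening the condition.\<close>

lemma fexE:
  assumes "p \<in> fex R \<phi>" "p \<in> Field R"
  obtains q x where "(q, p) \<in> R" "q \<in> \<phi> x"
  using assms refl unfolding fex_iff by blast

lemma fimpI:
  assumes "\<And>q. (q, p) \<in> R \<Longrightarrow> q \<in> \<phi> \<Longrightarrow> q \<in> \<psi>"
  shows "p \<in> (\<phi> \<^bold>\<longrightarrow>\<^bsub>R\<^esub> \<psi>)"
  using assms refl unfolding fimp_def fneg_def fand_def by (auto intro: FieldI1)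

text \<open>The abbreviation only says that no condition below \<open>p\<close> forces both the
  premise and the negated conclusion. So the conclusion is dense below \<open>q\<close>, and
  regularity turns density into truth.\<close>

lemma fimpD:
  assumes "p \<in> (\<phi> \<^bold>\<longrightarrow>\<^bsub>R\<^esub> \<psi>)" "(q, p) \<in> R" "q \<in> \<phi>" "regular \<phi>" "regular \<psi>"
  shows "q \<in> \<psi>"
proof (rule regular_dense[OF assms(5) FieldI1[OF assms(2)]])
  fix r assume r: "(r, q) \<in> R"
  then have "(r, p) \<in> R" "r \<in> \<phi>" using assms(2-4) trans regularD by blast+
  then show "\<exists>s. (s, r) \<in> R \<and> s \<in> \<psi>"
    using assms(1) unfolding fimp_def fneg_def fand_def by auto
qed

lemma fiffI:
  assumes "\<And>q. (q, p) \<in> R \<Longrightarrow> q \<in> \<phi> \<longleftrightarrow> q \<in> \<psi>"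
  shows "p \<in> (\<phi> \<^bold>\<longleftrightarrow>\<^bsub>R\<^esub> \<psi>)"
  unfolding fiff_def fand_iff using assms by (auto intro: fimpI)

lemma fiffD:
  assumes "p \<in> (\<phi> \<^bold>\<longleftrightarrow>\<^bsub>R\<^esub> \<psi>)" "(q, p) \<in> R" "regular \<phi>" "regular \<psi>"
  shows "q \<in> \<phi> \<longleftrightarrow> q \<in> \<psi>"
  using assms unfolding fiff_def fand_iff by (metis fimpD)

lemma fsub_iff:
  "p \<in> fsub R \<sigma> \<tau> \<longleftrightarrow> (\<forall>q x. (q, p) \<in> R \<longrightarrow> q \<in> fmem R x \<sigma> \<longrightarrow> q \<in> fmem R x \<tau>)"
  unfolding fsub_def fall_iff by (meson fimpD fimpI regular_fmem)

lemma feq_iff: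
  "p \<in> feq R \<sigma> \<tau> \<longleftrightarrow> (\<forall>q x. (q, p) \<in> R \<longrightarrow> (q \<in> fmem R x \<sigma> \<longleftrightarrow> q \<in> fmem R x \<tau>))"
  unfolding feq_def fall_iff by (meson fiffD fiffI regular_fmem)

lemma fmemI:
  assumes "(s, r) \<in> R" "(r, x) \<in> \<tau>"
  shows "s \<in> fmem R x \<tau>"
proof -
  have "(q, q) \<in> R \<and> (q, r) \<in> R" if "(q, s) \<in> R" for q
    using refl[OF FieldI1[OF that]] trans[OF that assms(1)] by blast
  then show ?thesis using assms(2) unfolding fmem_def by blast
qed

lemma fmem_chk: "p \<in> Field R \<Longrightarrow> p \<in> fmem R x (chk R X) \<longleftrightarrow> x \<in> X"
proof
  show "x \<in> X" if "p \<in> Field R" "p \<in> fmem R x (chk R X)"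
    using that refl unfolding fmem_def chk_def by blast
  show "p \<in> fmem R x (chk R X)" if "p \<in> Field R" "x \<in> X"
    using refl[OF that(1)] that by (intro fmemI[of p p]) (auto simp: chk_def)
qed

lemma fsub_chk: "p \<in> Field R \<Longrightarrow> p \<in> fsub R (chk R X) (chk R Y) \<longleftrightarrow> X \<subseteq> Y"
  unfolding fsub_iff using refl fmem_chk by (metis (no_types, lifting) FieldI1 subset_iff)

lemma fsub_chkD: "p \<in> fsub R \<tau> (chk R T) \<Longrightarrow> (q, p) \<in> R \<Longrightarrow> q \<in> fmem R x \<tau> \<Longrightarrow> x \<in> T"
  unfolding fsub_iff using fmem_chk by (metis FieldI1)

lemma feq_chkD: "p \<in> feq R \<tau> (chk R D) \<Longrightarrow> (q, p) \<in> R \<Longrightarrow> q \<in> fmem R x \<tau> \<longleftrightarrow> x \<in> D"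
  unfolding feq_iff using fmem_chk by (metis FieldI1)

lemma feq_refl: "p \<in> feq R \<tau> \<tau>"
  by (simp add: feq_iff)

lemma fmem_nimage:
  "p \<in> fmem R y (nimage g \<tau>) \<longleftrightarrow>
     (\<forall>q. (q, p) \<in> R \<longrightarrow> (\<exists>r x. (r, q) \<in> R \<and> g x = y \<and> r \<in> fmem R x \<tau>))" (is "?L \<longleftrightarrow> ?M")
proof
  assume L: ?L
  show ?M
  proof (intro allI impI)
    fix q assume "(q, p) \<in> R"
    then obtain s r x where s: "(s, q) \<in> R" "(s, r) \<in> R" "(r, x) \<in> \<tau>" "y = g x"
      using L unfolding fmem_def nimage_def by blast
    then have "s \<in> fmem R x \<tau>" by (intro fmemI)
    then show "\<exists>r x. (r, q) \<in> R \<and> g x = y \<and> r \<in> fmem R x \<tau>" using s by blast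
  qed
next
  assume M: ?M
  show ?L
    unfolding fmem_def
  proof (clarify)
    fix q assume "(q, p) \<in> R"
    then obtain r x where r: "(r, q) \<in> R" "g x = y" "r \<in> fmem R x \<tau>" using M by blast
    then obtain s t where s: "(s, r) \<in> R" "(s, t) \<in> R" "(t, x) \<in> \<tau>"
      using refl[OF FieldI1[OF r(1)]] unfolding fmem_def by blast
    then have "(t, y) \<in> nimage g \<tau>" using r(2) unfolding nimage_def by blast
    then show "\<exists>s t. (s, q) \<in> R \<and> (s, t) \<in> R \<and> (t, y) \<in> nimage g \<tau>"
      using trans[OF s(1) r(1)] s(2) by blast
  qed
qed

text \<open>Separation in the extension: pairing each element with all conditions forcing the
  formula names the subset that the formula defines.\<close>

lemma fmem_collect:
  assumes "p \<in> Field R" and reg: "\<And>x. regular (\<phi> x)"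
  shows "p \<in> fmem R x {(c, x). c \<in> Field R \<and> x \<in> T \<and> c \<in> \<phi> x} \<longleftrightarrow> x \<in> T \<and> p \<in> \<phi> x"
proof
  assume L: "p \<in> fmem R x {(c, x). c \<in> Field R \<and> x \<in> T \<and> c \<in> \<phi> x}"
  have "\<exists>s. (s, q) \<in> R \<and> s \<in> \<phi> x \<and> x \<in> T" if "(q, p) \<in> R" for q
    using L that regularD[OF reg] unfolding fmem_def by blast
  moreover from this have "p \<in> \<phi> x" by (intro regular_dense[OF reg assms(1)]) blast
  ultimately show "x \<in> T \<and> p \<in> \<phi> x" using refl[OF assms(1)] by blast
next
  assume h: "x \<in> T \<and> p \<in> \<phi> x"
  then show "p \<in> fmem R x {(c, x). c \<in> Field R \<and> x \<in> T \<and> c \<in> \<phi> x}"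
    using refl[OF assms(1)] assms(1) by (intro fmemI[of p p]) auto
qed

section \<open>Functions and Rudin-Keisler reductions in the forcing language\<close>

lemma is_function_chk_graph:
  assumes "p \<in> Field R" "\<And>x. x \<in> S \<Longrightarrow> g x \<in> T"
  shows "p \<in> is_function R S T (chk R ((\<lambda>x. (x, g x)) ` S))"
  unfolding is_function_def fand_iff fall_iff
proof (intro conjI allI fimpI)
  show "p \<in> fsub R (chk R ((\<lambda>x. (x, g x)) ` S)) (chk R (S \<times> T))"
    using assms(2) by (auto simp: fsub_chk[OF assms(1)])
  show "q \<in> fex R (\<lambda>y. fmem R (x, y) (chk R ((\<lambda>x. (x, g x)) ` S)))" if "(q, p) \<in> R" "q \<in> gnd (x \<in> S)" for q x
    by (rule fexI[of _ _ "g x"], rule regular_fmem)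
      (use that(2) in \<open>simp add: gnd_iff fmem_chk[OF FieldI1[OF that(1)]]\<close>)
  show "q \<in> gnd (y = z)"
    if "(q, p) \<in> R" "q \<in> (fmem R (x, y) (chk R ((\<lambda>x. (x, g x)) ` S)) \<^bold>\<and> fmem R (x, z) (chk R ((\<lambda>x. (x, g x)) ` S)))"
    for q x y z
    using that(2) by (auto simp: gnd_iff fand_iff fmem_chk[OF FieldI1[OF that(1)]])
qed

lemma rk_leI:
  assumes p: "p \<in> Field R" and h: "p \<in> is_function R S T h"
    and reg: "\<And>A. regular (V A)" "\<And>A. regular (U A)"
    and *: "\<And>q A P. (q, p) \<in> R \<Longrightarrow> q \<in> fsub R A (chk R T) \<Longrightarrow>
       (\<And>r x. (r, q) \<in> R \<Longrightarrow> r \<in> fmem R x P \<longleftrightarrow> r \<in> fex R (\<lambda>y. fmem R (x, y) h \<^bold>\<and> fmem R y A)) \<Longrightarrow>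
       q \<in> V A \<longleftrightarrow> q \<in> U P"
  shows "p \<in> rk_le R T V S U"
proof -
  let ?\<phi> = "\<lambda>h. (is_function R S T h \<^bold>\<and>
     (\<^bold>\<forall>A. \<^bold>\<forall>P. (fsub R A (chk R T) \<^bold>\<and>
        (\<^bold>\<forall>x. fmem R x P \<^bold>\<longleftrightarrow>\<^bsub>R\<^esub> fex R (\<lambda>y. fmem R (x, y) h \<^bold>\<and> fmem R y A)))
        \<^bold>\<longrightarrow>\<^bsub>R\<^esub> (V A \<^bold>\<longleftrightarrow>\<^bsub>R\<^esub> U P)))"
  have "regular (?\<phi> h)" for h by (intro regular_intros reg)
  moreover have "p \<in> ?\<phi> h"
    unfolding fand_iff fall_iff
  proof (intro conjI allI fimpI fiffI h)
    fix A P q r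
    assume q: "(q, p) \<in> R" and r: "(r, q) \<in> R"
      and "q \<in> (fsub R A (chk R T) \<^bold>\<and>
        (\<^bold>\<forall>x. fmem R x P \<^bold>\<longleftrightarrow>\<^bsub>R\<^esub> fex R (\<lambda>y. fmem R (x, y) h \<^bold>\<and> fmem R y A)))"
    then have A: "q \<in> fsub R A (chk R T)"
      "\<And>x. q \<in> (fmem R x P \<^bold>\<longleftrightarrow>\<^bsub>R\<^esub> fex R (\<lambda>y. fmem R (x, y) h \<^bold>\<and> fmem R y A))"
      unfolding fand_iff fall_iff by blast+
    show "r \<in> V A \<longleftrightarrow> r \<in> U P"
    proof (rule *)
      show "(r, p) \<in> R" using q r trans by blast
      show "r \<in> fsub R A (chk R T)" using A(1) r by (rule regularD[OF regular_fsub])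
      show "s \<in> fmem R x P \<longleftrightarrow> s \<in> fex R (\<lambda>y. fmem R (x, y) h \<^bold>\<and> fmem R y A)" if "(s, r) \<in> R" for s x
      proof (rule fiffD)
        show "q \<in> (fmem R x P \<^bold>\<longleftrightarrow>\<^bsub>R\<^esub> fex R (\<lambda>y. fmem R (x, y) h \<^bold>\<and> fmem R y A))" by (rule A)
        show "(s, q) \<in> R" using r that trans by blast
      qed (intro regular_intros)+
    qed
  qed
  ultimately show ?thesis unfolding rk_le_def by (rule fexI)
qed

lemma fex_chk_graph:
  assumes "p \<in> Field R"
  shows "p \<in> fex R (\<lambda>y. fmem R (x, y) (chk R ((\<lambda>x. (x, g x)) ` S)) \<^bold>\<and> fmem R y A) \<longleftrightarrow>
    x \<in> S \<and> p \<in> fmem R (g x) A"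
proof
  assume L: "p \<in> fex R (\<lambda>y. fmem R (x, y) (chk R ((\<lambda>x. (x, g x)) ` S)) \<^bold>\<and> fmem R y A)"
  have "\<exists>r. (r, q) \<in> R \<and> x \<in> S \<and> r \<in> fmem R (g x) A" if q: "(q, p) \<in> R" for q
  proof -
    obtain r y where r: "(r, q) \<in> R" "r \<in> fmem R (x, y) (chk R ((\<lambda>x. (x, g x)) ` S))" "r \<in> fmem R y A"
      using L q unfolding fex_iff fand_iff by blast
    then show ?thesis by (auto simp: fmem_chk[OF FieldI1[OF r(1)]])
  qed
  moreover from this have "p \<in> fmem R (g x) A" by (intro regular_dense[OF regular_fmem assms]) blast
  ultimately show "x \<in> S \<and> p \<in> fmem R (g x) A" using refl[OF assms] by blast
next
  assume "x \<in> S \<and> p \<in> fmem R (g x) A"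
  then show "p \<in> fex R (\<lambda>y. fmem R (x, y) (chk R ((\<lambda>x. (x, g x)) ` S)) \<^bold>\<and> fmem R y A)"
    by (intro fexI[of _ _ "g x"] regular_fand regular_fmem) (simp add: fand_iff fmem_chk[OF assms])
qed

lemma rk_leE:
  assumes le: "p \<in> rk_le R T V S U" and p: "p \<in> Field R"
    and reg: "\<And>A. regular (V A)" "\<And>A. regular (U A)"
  obtains q h where "(q, p) \<in> R" "q \<in> is_function R S T h"
    "\<forall>r A P. (r, q) \<in> R \<longrightarrow> r \<in> fsub R A (chk R T) \<longrightarrow>
       (\<forall>s x. (s, r) \<in> R \<longrightarrow> (s \<in> fmem R x P \<longleftrightarrow> s \<in> fex R (\<lambda>y. fmem R (x, y) h \<^bold>\<and> fmem R y A))) \<longrightarrow>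
       (r \<in> V A \<longleftrightarrow> r \<in> U P)"
proof -
  obtain q h where q: "(q, p) \<in> R"
    and "q \<in> (is_function R S T h \<^bold>\<and>
     (\<^bold>\<forall>A. \<^bold>\<forall>P. (fsub R A (chk R T) \<^bold>\<and>
        (\<^bold>\<forall>x. fmem R x P \<^bold>\<longleftrightarrow>\<^bsub>R\<^esub> fex R (\<lambda>y. fmem R (x, y) h \<^bold>\<and> fmem R y A)))
        \<^bold>\<longrightarrow>\<^bsub>R\<^esub> (V A \<^bold>\<longleftrightarrow>\<^bsub>R\<^esub> U P)))"
    using le p unfolding rk_le_def by (rule fexE)
  then have h: "q \<in> is_function R S T h"
    and imp: "\<And>A P. q \<in> ((fsub R A (chk R T) \<^bold>\<and>
        (\<^bold>\<forall>x. fmem R x P \<^bold>\<longleftrightarrow>\<^bsub>R\<^esub> fex R (\<lambda>y. fmem R (x, y) h \<^bold>\<and> fmem R y A)))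
        \<^bold>\<longrightarrow>\<^bsub>R\<^esub> (V A \<^bold>\<longleftrightarrow>\<^bsub>R\<^esub> U P))"
    unfolding fand_iff fall_iff by simp_all
  show thesis
  proof (rule that[OF q h], intro allI impI)
    fix r A P
    assume r: "(r, q) \<in> R" and A: "r \<in> fsub R A (chk R T)"
      and P: "\<forall>s x. (s, r) \<in> R \<longrightarrow> (s \<in> fmem R x P \<longleftrightarrow> s \<in> fex R (\<lambda>y. fmem R (x, y) h \<^bold>\<and> fmem R y A))"
    have "r \<in> (fsub R A (chk R T) \<^bold>\<and>
        (\<^bold>\<forall>x. fmem R x P \<^bold>\<longleftrightarrow>\<^bsub>R\<^esub> fex R (\<lambda>y. fmem R (x, y) h \<^bold>\<and> fmem R y A)))"
      unfolding fand_iff fall_iff by (intro conjI A allI fiffI) (simp add: P)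
    then have "r \<in> (V A \<^bold>\<longleftrightarrow>\<^bsub>R\<^esub> U P)"
      by (rule fimpD[OF imp r]) (intro regular_intros reg)+
    then show "r \<in> V A \<longleftrightarrow> r \<in> U P"
      using refl[OF FieldI1[OF r]] by (rule fiffD) (intro reg)+
  qed
qed

text \<open>Single-valuedness of \<open>h\<close> identifies any witness \<open>y\<close> with the
  decided value \<open>f x\<close>. So preimages under the named function can be computed with the
  ground function \<open>f\<close>.\<close>

lemma fex_decided_function:
  assumes p: "p \<in> Field R" and h: "p \<in> is_function R S T h"
    and f: "\<And>x. x \<in> S \<Longrightarrow> p \<in> fmem R (x, f x) h"
  shows "p \<in> fex R (\<lambda>y. fmem R (x, y) h \<^bold>\<and> fmem R y A) \<longleftrightarrow> x \<in> S \<and> p \<in> fmem R (f x) A"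
proof
  assume L: "p \<in> fex R (\<lambda>y. fmem R (x, y) h \<^bold>\<and> fmem R y A)"
  have sub: "p \<in> fsub R h (chk R (S \<times> T))"
    and single: "\<And>y z. p \<in> ((fmem R (x, y) h \<^bold>\<and> fmem R (x, z) h) \<^bold>\<longrightarrow>\<^bsub>R\<^esub> gnd (y = z))"
    using h unfolding is_function_def fand_iff fall_iff by simp_all
  have *: "\<exists>r. (r, q) \<in> R \<and> x \<in> S \<and> r \<in> fmem R (f x) A" if q: "(q, p) \<in> R" for q
  proof -
    obtain r y where r: "(r, q) \<in> R" "r \<in> (fmem R (x, y) h \<^bold>\<and> fmem R y A)"
      using fexE[OF regularD[OF regular_fex L q] FieldI1[OF q]] regular_fand regular_fmem by metis
    have rp: "(r, p) \<in> R" using r(1) q by (rule trans)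
    have y: "r \<in> fmem R (x, y) h" "r \<in> fmem R y A" using r(2) unfolding fand_iff by simp_all
    have x: "x \<in> S" using fsub_chkD[OF sub rp y(1)] by simp
    have "r \<in> fmem R (x, f x) h" using f[OF x] rp by (rule regularD[OF regular_fmem])
    then have "r \<in> (fmem R (x, y) h \<^bold>\<and> fmem R (x, f x) h)" using y(1) unfolding fand_iff by simp
    then have "r \<in> gnd (y = f x)" by (rule fimpD[OF single rp]) (intro regular_intros)+
    then show ?thesis using r(1) x y(2) by (auto simp: gnd_iff)
  qed
  then have "p \<in> fmem R (f x) A" by (intro regular_dense[OF regular_fmem p]) meson
  then show "x \<in> S \<and> p \<in> fmem R (f x) A" using *[OF refl[OF p]] by meson
next
  assume "x \<in> S \<and> p \<in> fmem R (f x) A"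
  then show "p \<in> fex R (\<lambda>y. fmem R (x, y) h \<^bold>\<and> fmem R y A)"
    by (intro fexI[of _ _ "f x"] regular_fand regular_fmem) (simp add: fand_iff f)
qed

lemma filter_upward:
  assumes "q \<in> is_filter_on R S F" "\<And>A. regular (F A)" "(r, q) \<in> R"
    and "r \<in> F A" "r \<in> fsub R A B" "r \<in> fsub R B (chk R S)"
  shows "r \<in> F B"
proof -
  have "q \<in> ((F A \<^bold>\<and> fsub R A B \<^bold>\<and> fsub R B (chk R S)) \<^bold>\<longrightarrow>\<^bsub>R\<^esub> F B)"
    using assms(1) unfolding is_filter_on_def fand_iff fall_iff by simp
  moreover have "r \<in> (F A \<^bold>\<and> fsub R A B \<^bold>\<and> fsub R B (chk R S))"
    using assms(4-6) unfolding fand_iff by simp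
  ultimately show ?thesis
    by (rule fimpD[OF _ assms(3)]) (intro regular_intros assms(2))+
qed

end

section \<open>Countable closure and deciding names\<close>

locale sigma_closed_forcing = forcing +
  assumes lower_bound: "(\<And>n. (p (Suc n), p n) \<in> R) \<Longrightarrow> \<exists>q. \<forall>n :: nat. (q, p n) \<in> R"
begin

lemma meet_countably_many_dense:
  fixes D :: "nat \<Rightarrow> 'a set"
  assumes p: "p \<in> Field R"
    and down: "\<And>n q r. q \<in> D n \<Longrightarrow> (r, q) \<in> R \<Longrightarrow> r \<in> D n"
    and dense: "\<And>n q. (q, p) \<in> R \<Longrightarrow> \<exists>r. (r, q) \<in> R \<and> r \<in> D n"
  shows "\<exists>q. (q, p) \<in> R \<and> (\<forall>n. q \<in> D n)"
proof -
  have "\<exists>s. \<forall>n. ((s n, p) \<in> R \<and> s n \<in> D n) \<and> (s (Suc n), s n) \<in> R"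
  proof (rule dependent_nat_choice)
    show "\<exists>x. (x, p) \<in> R \<and> x \<in> D 0" using dense refl[OF p] by blast
    show "\<exists>y. ((y, p) \<in> R \<and> y \<in> D (Suc n)) \<and> (y, x) \<in> R" if "(x, p) \<in> R \<and> x \<in> D n" for x n
      using dense[of x "Suc n"] that trans by blast
  qed
  then obtain s where s: "\<And>n. (s n, p) \<in> R" "\<And>n. s n \<in> D n" "\<And>n. (s (Suc n), s n) \<in> R" by blast
  then obtain q where q: "\<And>n. (q, s n) \<in> R" using lower_bound by blast
  have "q \<in> D n" for n using s(2) q by (rule down)
  moreover have "(q, p) \<in> R" using q s(1) by (rule trans)
  ultimately show ?thesis by blast
qed

text \<open>For each element of \<open>T\<close>, deciding its membership is a dense requirement,
  and countable closure meets countably many of them.\<close>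

lemma decide_countable_name:
  assumes T: "countable T" and sub: "p \<in> fsub R \<tau> (chk R T)" and p: "p \<in> Field R"
  shows "\<exists>q D. (q, p) \<in> R \<and> D \<subseteq> T \<and> q \<in> feq R \<tau> (chk R D)"
proof -
  define \<Delta> where "\<Delta> n = (let x = from_nat_into T n in fmem R x \<tau> \<union> (\<^bold>\<not>\<^bsub>R\<^esub> fmem R x \<tau>))" for n
  have "\<exists>q. (q, p) \<in> R \<and> (\<forall>n. q \<in> \<Delta> n)"
  proof (rule meet_countably_many_dense[OF p])
    show "r \<in> \<Delta> n" if "q \<in> \<Delta> n" "(r, q) \<in> R" for n q r
      using that(1) regularD[OF regular_fmem _ that(2)]
        regularD[OF regular_fneg[OF regular_fmem] _ that(2)]
      unfolding \<Delta>_def Let_def by (meson UnCI UnE)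
    show "\<exists>r. (r, q) \<in> R \<and> r \<in> \<Delta> n" if "(q, p) \<in> R" for n q
      using refl[OF FieldI1[OF that]] unfolding \<Delta>_def Let_def fneg_def by blast
  qed
  then obtain q where q: "(q, p) \<in> R" "\<And>n. q \<in> \<Delta> n" by blast
  define D where "D = {x \<in> T. q \<in> fmem R x \<tau>}"
  have "r \<in> fmem R x \<tau> \<longleftrightarrow> r \<in> fmem R x (chk R D)" if r: "(r, q) \<in> R" for r x
  proof -
    have rF: "r \<in> Field R" using r by (rule FieldI1)
    have mem: "x \<in> T" if "r \<in> fmem R x \<tau>"
      using sub trans[OF r q(1)] that by (rule fsub_chkD)
    have "q \<in> fmem R x \<tau>" if x: "x \<in> T" "r \<in> fmem R x \<tau>"
    proof -
      obtain n where "x = from_nat_into T n"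
        using x(1) T by (metis from_nat_into_surj)
      then show ?thesis using q(2)[of n] x(2) r unfolding \<Delta>_def Let_def fneg_def by auto
    qed
    moreover have "r \<in> fmem R x \<tau>" if "q \<in> fmem R x \<tau>" using that r by (rule regularD[OF regular_fmem])
    moreover have "x \<in> D \<longleftrightarrow> x \<in> T \<and> q \<in> fmem R x \<tau>" by (simp add: D_def)
    ultimately show ?thesis unfolding fmem_chk[OF rF] using mem by argo
  qed
  then have "q \<in> feq R \<tau> (chk R D)" unfolding feq_iff by blast
  moreover have "D \<subseteq> T" by (auto simp: D_def)
  ultimately show ?thesis using q(1) by (intro exI[of _ q] exI[of _ D] conjI)
qed

text \<open>Only the domain has to be countable: each argument needs one dense requirement, whatever
  the size of \<open>T\<close>.\<close>

lemma decide_function: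
  assumes S: "countable S" and h: "p \<in> is_function R S T h" and p: "p \<in> Field R"
  shows "\<exists>q f. (q, p) \<in> R \<and> (\<forall>x\<in>S. f x \<in> T \<and> q \<in> fmem R (x, f x) h)"
proof -
  \<comment> \<open>The guard covers empty \<open>S\<close>, where \<open>from_nat_into\<close>
    cannot return a member of \<open>S\<close>.\<close>
  define \<Delta> where "\<Delta> n = {q. from_nat_into S n \<in> S \<longrightarrow> (\<exists>y. q \<in> fmem R (from_nat_into S n, y) h)}" for n
  have \<Delta>: "q \<in> \<Delta> n \<longleftrightarrow> (from_nat_into S n \<in> S \<longrightarrow> (\<exists>y. q \<in> fmem R (from_nat_into S n, y) h))" for q n
    by (simp add: \<Delta>_def)
  have "\<exists>q. (q, p) \<in> R \<and> (\<forall>n. q \<in> \<Delta> n)"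
  proof (rule meet_countably_many_dense[OF p])
    show "r \<in> \<Delta> n" if "q \<in> \<Delta> n" "(r, q) \<in> R" for n q r
      using that(1) regularD[OF regular_fmem _ that(2)] unfolding \<Delta> by meson
    show "\<exists>r. (r, q) \<in> R \<and> r \<in> \<Delta> n" if q: "(q, p) \<in> R" for n q
    proof (cases "from_nat_into S n \<in> S")
      case True
      let ?x = "from_nat_into S n"
      have "p \<in> (gnd (?x \<in> S) \<^bold>\<longrightarrow>\<^bsub>R\<^esub> fex R (\<lambda>y. fmem R (?x, y) h))"
        using h unfolding is_function_def fand_iff fall_iff by simp
      then have "q \<in> fex R (\<lambda>y. fmem R (?x, y) h)"
        by (rule fimpD[OF _ q]) (simp_all add: gnd_iff True regular_intros)
      then obtain r y where "(r, q) \<in> R" "r \<in> fmem R (?x, y) h"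
        using FieldI1[OF q] by (rule fexE)
      then show ?thesis unfolding \<Delta> by meson
    next
      case False
      then show ?thesis using refl[OF FieldI1[OF q]] unfolding \<Delta> by meson
    qed
  qed
  then obtain q where q: "(q, p) \<in> R" "\<And>n. q \<in> \<Delta> n" by (elim exE conjE) simp
  have "\<exists>y. y \<in> T \<and> q \<in> fmem R (x, y) h" if x: "x \<in> S" for x
  proof -
    obtain n where n: "x = from_nat_into S n" using x S by (metis from_nat_into_surj)
    then obtain y where y: "q \<in> fmem R (x, y) h" using q(2)[of n] x unfolding \<Delta> by metis
    have "p \<in> fsub R h (chk R (S \<times> T))" using h unfolding is_function_def fand_iff by simp
    then have "(x, y) \<in> S \<times> T"
      using q(1) y by (rule fsub_chkD)
    then show ?thesis using y by blast
  qed
  then show ?thesis using q(1) by metis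
qed

end

section \<open>The quotient forcing\<close>

definition cls :: "nat \<Rightarrow> nat list set \<Rightarrow> nat list set set" where
  "cls k X = fin_tensor_equiv k `` {X}"

text \<open>The condition \<open>c\<close> forces \<open>X \<in> \<G>\<^sub>k\<close>; see \<open>generic_uf_chk\<close>.\<close>

definition below :: "nat \<Rightarrow> nat list set set \<Rightarrow> nat list set \<Rightarrow> bool" where
  "below k c X \<longleftrightarrow> (\<exists>Y\<in>c. \<not> pos k (Y - X))"

lemma not_pos_subset_Un: "A \<subseteq> B \<union> C \<Longrightarrow> \<not> pos k B \<Longrightarrow> \<not> pos k C \<Longrightarrow> \<not> pos k A"
  using pos_mono pos_Un by metis

lemma mem_cls_iff:
  assumes "X \<subseteq> omega_pow k"
  shows "Y \<in> cls k X \<longleftrightarrow> Y \<subseteq> omega_pow k \<and> \<not> pos k (X - Y) \<and> \<not> pos k (Y - X)"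
proof -
  have "(X - Y) \<union> (Y - X) \<in> fin_tensor k \<longleftrightarrow> \<not> pos k (X - Y) \<and> \<not> pos k (Y - X)"
    if "Y \<subseteq> omega_pow k"
  proof -
    have "(X - Y) \<union> (Y - X) \<in> fin_tensor k \<longleftrightarrow> \<not> pos k ((X - Y) \<union> (Y - X))"
      using assms that by (intro fin_tensor_iff_not_pos) blast
    also have "\<dots> \<longleftrightarrow> \<not> pos k (X - Y) \<and> \<not> pos k (Y - X)"
      using pos_mono pos_Un by (metis Un_upper1 Un_upper2)
    finally show ?thesis .
  qed
  then show ?thesis using assms by (auto simp: cls_def fin_tensor_equiv_def)
qed

lemma self_mem_cls: "X \<subseteq> omega_pow k \<Longrightarrow> X \<in> cls k X"
  by (simp add: mem_cls_iff)

lemma cls_eq_iff: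
  assumes "X \<subseteq> omega_pow k" "Y \<subseteq> omega_pow k"
  shows "cls k X = cls k Y \<longleftrightarrow> \<not> pos k (X - Y) \<and> \<not> pos k (Y - X)"
proof
  assume "cls k X = cls k Y"
  then have "X \<in> cls k Y" using assms(1) self_mem_cls by blast
  then show "\<not> pos k (X - Y) \<and> \<not> pos k (Y - X)" using assms(2) by (simp add: mem_cls_iff)
next
  assume h: "\<not> pos k (X - Y) \<and> \<not> pos k (Y - X)"
  have "Z \<in> cls k X \<longleftrightarrow> Z \<in> cls k Y" for Z
  proof -
    have "X - Z \<subseteq> (X - Y) \<union> (Y - Z)" "Z - X \<subseteq> (Z - Y) \<union> (Y - X)"
      "Y - Z \<subseteq> (Y - X) \<union> (X - Z)" "Z - Y \<subseteq> (Z - X) \<union> (X - Y)" by blast+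
    then show ?thesis unfolding mem_cls_iff[OF assms(1)] mem_cls_iff[OF assms(2)]
      using h not_pos_subset_Un by metis
  qed
  then show "cls k X = cls k Y" by blast
qed

lemma fin_quotient_iff:
  "c \<in> fin_quotient k \<longleftrightarrow> (\<exists>X\<subseteq>omega_pow k. pos k X \<and> c = cls k X)"
proof -
  have "cls k X \<noteq> cls k {} \<longleftrightarrow> pos k X" if "X \<subseteq> omega_pow k" for X
    using cls_eq_iff[OF that, of "{}"] by simp
  then show ?thesis unfolding fin_quotient_def quotient_def cls_def[symmetric] by blast
qed

lemma below_cls_iff:
  assumes "X \<subseteq> omega_pow k"
  shows "below k (cls k X) Z \<longleftrightarrow> \<not> pos k (X - Z)"
proof
  assume "below k (cls k X) Z"
  then obtain Y where Y: "Y \<in> cls k X" "\<not> pos k (Y - Z)" by (auto simp: below_def)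
  have "X - Z \<subseteq> (X - Y) \<union> (Y - Z)" by blast
  then show "\<not> pos k (X - Z)" using Y not_pos_subset_Un mem_cls_iff[OF assms] by metis
qed (use self_mem_cls[OF assms] in \<open>auto simp: below_def\<close>)

text \<open>Independence of representatives: passing to other members of the classes changes the
  difference only by two negligible sets.\<close>

lemma fin_forcing_cls_iff:
  assumes X: "X \<subseteq> omega_pow k" "pos k X" and Y: "Y \<subseteq> omega_pow k" "pos k Y"
  shows "(cls k X, cls k Y) \<in> fin_forcing k \<longleftrightarrow> \<not> pos k (X - Y)"
proof
  assume "(cls k X, cls k Y) \<in> fin_forcing k"
  then obtain X' Y' where h: "X' \<in> cls k X" "Y' \<in> cls k Y" "X' - Y' \<in> fin_tensor k"
    unfolding fin_forcing_def by blast
  then have h': "\<not> pos k (X - X')" "\<not> pos k (Y' - Y)" "X' \<subseteq> omega_pow k"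
    using mem_cls_iff[OF X(1)] mem_cls_iff[OF Y(1)] by blast+
  then have "\<not> pos k (X' - Y')" using h(3) fin_tensor_iff_not_pos[of "X' - Y'" k] by blast
  moreover have "X - Y \<subseteq> (X - X') \<union> ((X' - Y') \<union> (Y' - Y))" by blast
  ultimately show "\<not> pos k (X - Y)" using h' not_pos_subset_Un by (metis order_refl)
next
  assume "\<not> pos k (X - Y)"
  then have "X - Y \<in> fin_tensor k" using fin_tensor_iff_not_pos[of "X - Y" k] X(1) by blast
  moreover have "cls k X \<in> fin_quotient k" "cls k Y \<in> fin_quotient k"
    using X Y unfolding fin_quotient_iff by blast+
  ultimately show "(cls k X, cls k Y) \<in> fin_forcing k"
    using self_mem_cls X(1) Y(1) unfolding fin_forcing_def by blast
qed

lemma fin_forcingE: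
  assumes "(c, d) \<in> fin_forcing k"
  obtains X Y where "X \<subseteq> omega_pow k" "pos k X" "c = cls k X" "Y \<subseteq> omega_pow k" "pos k Y" "d = cls k Y"
    "\<not> pos k (X - Y)"
proof -
  have "c \<in> fin_quotient k" "d \<in> fin_quotient k" using assms by (auto simp: fin_forcing_def)
  then obtain X Y where h: "X \<subseteq> omega_pow k" "pos k X" "c = cls k X" "Y \<subseteq> omega_pow k" "pos k Y" "d = cls k Y"
    unfolding fin_quotient_iff by blast
  then have "\<not> pos k (X - Y)" using assms by (simp add: fin_forcing_cls_iff)
  with h show thesis by (rule that)
qed

lemma fin_forcing_refl: "c \<in> fin_quotient k \<Longrightarrow> (c, c) \<in> fin_forcing k"
  unfolding fin_quotient_iff using fin_forcing_cls_iff by (metis Diff_cancel not_pos_empty)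

lemma Field_fin_forcing: "Field (fin_forcing k) = fin_quotient k"
  using fin_forcing_refl by (fastforce simp: fin_forcing_def Field_def)

lemma below_trans:
  assumes "(d, c) \<in> fin_forcing k" "below k c Z"
  shows "below k d Z"
proof -
  obtain X Y where h: "X \<subseteq> omega_pow k" "d = cls k X" "Y \<subseteq> omega_pow k" "c = cls k Y" "\<not> pos k (X - Y)"
    using assms(1) by (rule fin_forcingE)
  have "X - Z \<subseteq> (X - Y) \<union> (Y - Z)" by blast
  then show ?thesis
    using h assms(2) not_pos_subset_Un unfolding h(2,4) below_cls_iff[OF h(1)] below_cls_iff[OF h(3)]
    by metis
qed

lemma fin_forcing_trans:
  assumes "(r, q) \<in> fin_forcing k" "(q, p) \<in> fin_forcing k"
  shows "(r, p) \<in> fin_forcing k"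
proof -
  obtain X Y where h: "X \<subseteq> omega_pow k" "pos k X" "q = cls k X" "Y \<subseteq> omega_pow k" "pos k Y" "p = cls k Y"
    "\<not> pos k (X - Y)"
    using assms(2) by (rule fin_forcingE)
  obtain Z where z: "Z \<subseteq> omega_pow k" "pos k Z" "r = cls k Z"
    using assms(1) by (rule fin_forcingE)
  have "below k q Y" using h below_cls_iff by simp
  then have "below k r Y" using assms(1) below_trans by blast
  then show ?thesis using z h(4-6) by (simp add: below_cls_iff fin_forcing_cls_iff)
qed

lemma below_mono: "below k c X \<Longrightarrow> X \<subseteq> Y \<Longrightarrow> below k c Y"
  unfolding below_def using pos_mono by (metis Diff_mono order_refl)

lemma below_Int:
  assumes "c \<in> Field (fin_forcing k)" "below k c X" "below k c Y"
  shows "below k c (X \<inter> Y)"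
proof -
  obtain Z where Z: "Z \<subseteq> omega_pow k" "c = cls k Z"
    using assms(1) unfolding Field_fin_forcing fin_quotient_iff by blast
  have "Z - X \<inter> Y \<subseteq> (Z - X) \<union> (Z - Y)" by blast
  then show ?thesis
    using assms(2,3) not_pos_subset_Un unfolding Z(2) below_cls_iff[OF Z(1)] by metis
qed

lemma not_below_empty: "c \<in> Field (fin_forcing k) \<Longrightarrow> \<not> below k c {}"
  unfolding Field_fin_forcing fin_quotient_iff using below_cls_iff by auto

text \<open>Intersecting a representative of \<open>c\<close> with \<open>X\<close> loses only a
  negligible part. This replaces a condition by an actual set that can be thinned out freely while
  its class stays below \<open>c\<close>.\<close>

lemma below_imp_positive_subset:
  assumes "c \<in> Field (fin_forcing k)" "below k c X"
  shows "\<exists>Y\<subseteq>X. Y \<subseteq> omega_pow k \<and> pos k Y \<and> (\<forall>Z\<subseteq>Y. pos k Z \<longrightarrow> (cls k Z, c) \<in> fin_forcing k)"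
proof -
  obtain Y where Y: "Y \<subseteq> omega_pow k" "pos k Y" "c = cls k Y"
    using assms(1) unfolding Field_fin_forcing fin_quotient_iff by blast
  have "\<not> pos k (Y - X)" using assms(2) Y below_cls_iff by blast
  then have "pos k (Y \<inter> X)" using Y(2) not_pos_subset_Un[of Y "Y \<inter> X" "Y - X"] by blast
  moreover have "(cls k Z, c) \<in> fin_forcing k" if "Z \<subseteq> Y \<inter> X" "pos k Z" for Z
  proof -
    have "Z \<subseteq> omega_pow k" "Z - Y = {}" using that(1) Y(1) by blast+
    then show ?thesis using Y that(2) fin_forcing_cls_iff not_pos_empty by metis
  qed
  ultimately show ?thesis using Y(1) by (intro exI[of _ "Y \<inter> X"]) blast
qed

text \<open>The quotient is separative: otherwise the part of a representative outside
  \<open>X\<close> is positive, and its class has no strengthening that is below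
  \<open>X\<close>.\<close>

lemma below_dense:
  assumes c: "c \<in> Field (fin_forcing k)"
    and dense: "\<And>d. (d, c) \<in> fin_forcing k \<Longrightarrow> \<exists>e. (e, d) \<in> fin_forcing k \<and> below k e X"
  shows "below k c X"
proof (rule ccontr)
  assume n: "\<not> below k c X"
  obtain Y where Y: "Y \<subseteq> omega_pow k" "pos k Y" "c = cls k Y"
    using c unfolding Field_fin_forcing fin_quotient_iff by blast
  have Z: "Y - X \<subseteq> omega_pow k" "pos k (Y - X)" using Y(1) n unfolding Y(3) below_cls_iff[OF Y(1)] by blast+
  have "(Y - X) - Y = {}" by blast
  then have "(cls k (Y - X), c) \<in> fin_forcing k" using Y Z fin_forcing_cls_iff not_pos_empty by metis
  then obtain e where e: "(e, cls k (Y - X)) \<in> fin_forcing k" "below k e X" using dense by blast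
  have "below k (cls k (Y - X)) (Y - X)" using below_cls_iff[OF Z(1)] by simp
  then have "below k e (Y - X)" using below_trans e(1) by blast
  then have "below k e (X \<inter> (Y - X))" using below_Int[OF FieldI1[OF e(1)] e(2)] by blast
  moreover have "X \<inter> (Y - X) = {}" by blast
  ultimately show False using not_below_empty[OF FieldI1[OF e(1)]] by simp
qed

lemma fin_forcing_lower_bound:
  assumes k: "1 \<le> k" and dec: "\<And>n. (p (Suc n), p n) \<in> fin_forcing k"
  shows "\<exists>q. \<forall>n :: nat. (q, p n) \<in> fin_forcing k"
proof -
  have "p n \<in> fin_quotient k" for n using dec[of n] by (auto simp: fin_forcing_def)
  then obtain X where X: "\<And>n. X n \<subseteq> omega_pow k" "\<And>n. pos k (X n)" "\<And>n. p n = cls k (X n)"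
    unfolding fin_quotient_iff by metis
  \<comment> \<open>The representatives decrease only modulo the ideal. Their finite intersections
    decrease outright and remain positive, since each contains a representative of
    \<open>p n\<close> up to a negligible set.\<close>
  define Y where "Y n = (\<Inter>i\<le>n. X i)" for n
  have le: "(p (n + m), p n) \<in> fin_forcing k" for n m
  proof (induction m)
    case 0
    then show ?case using \<open>\<And>n. p n \<in> fin_quotient k\<close> by (simp add: fin_forcing_refl)
  next
    case (Suc m)
    then show ?case using dec[of "n + m"] fin_forcing_trans by simp
  qed
  have below_X: "below k (p n) (X i)" if "i \<le> n" for i n
  proof -
    have "(p n, p i) \<in> fin_forcing k" using le[of i "n - i"] that by simp
    moreover have "below k (p i) (X i)" using X below_cls_iff by simp
    ultimately show ?thesis by (rule below_trans)
  qed
  have pF: "p n \<in> Field (fin_forcing k)" for n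
    unfolding Field_fin_forcing by fact
  have "below k (p n) (\<Inter>i\<le>m. X i)" if "m \<le> n" for m n
    using that
  proof (induction m)
    case (Suc m)
    have "(\<Inter>i\<le>Suc m. X i) = (\<Inter>i\<le>m. X i) \<inter> X (Suc m)" by (auto simp: atMost_Suc)
    moreover have "below k (p n) (X (Suc m))" using Suc.prems by (rule below_X)
    ultimately show ?case using Suc below_Int[OF pF] by simp
  qed (simp add: below_X)
  then have "below k (p n) (Y n)" for n by (simp add: Y_def)
  then have "pos k (Y n)" for n
    using below_imp_positive_subset[OF pF, of n "Y n"] pos_mono[of k _ "Y n"] by metis
  moreover have "Y (Suc n) \<subseteq> Y n" for n by (auto simp: Y_def)
  ultimately obtain Z where Z: "Z \<subseteq> Y 0" "pos k Z" "\<And>n. \<not> pos k (Z - Y n)"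
    using pos_pseudo_intersection[of "k - 1" Y] k by auto
  have "Z \<subseteq> omega_pow k" using Z(1) X(1)[of 0] by (auto simp: Y_def)
  moreover have "\<not> pos k (Z - X n)" for n
  proof -
    have "Z - X n \<subseteq> Z - Y n" by (auto simp: Y_def)
    then show ?thesis using Z(3) pos_mono by blast
  qed
  ultimately have "(cls k Z, p n) \<in> fin_forcing k" for n
    using X Z(2) by (simp add: fin_forcing_cls_iff)
  then show ?thesis by blast
qed

lemma sigma_closed_fin_forcing:
  assumes "1 \<le> k"
  shows "sigma_closed_forcing (fin_forcing k)"
proof
  show "(p, p) \<in> fin_forcing k" if "p \<in> Field (fin_forcing k)" for p
    using that fin_forcing_refl unfolding Field_fin_forcing by blast
  show "(r, p) \<in> fin_forcing k" if "(r, q) \<in> fin_forcing k" "(q, p) \<in> fin_forcing k" for r q p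
    using that by (rule fin_forcing_trans)
  show "\<exists>q. \<forall>n. (q, p n) \<in> fin_forcing k" if "\<And>n. (p (Suc n), p n) \<in> fin_forcing k" for p :: "nat \<Rightarrow> nat list set set"
    using assms that by (rule fin_forcing_lower_bound)
qed

section \<open>Images of the generic ultrafilter\<close>

text \<open>The default point \<open>y0\<close> keeps all values inside the image of
  \<open>Y\<close> under \<open>v\<close>, also at arguments not of the form \<open>u y\<close>.
  This makes the factor map a total function into the required codomain.\<close>

lemma factor_through:
  assumes "\<And>x y. x \<in> Y \<Longrightarrow> y \<in> Y \<Longrightarrow> u x = u y \<Longrightarrow> v x = v y" "y0 \<in> Y"
  shows "\<exists>g. (\<forall>y\<in>Y. g (u y) = v y) \<and> range g \<subseteq> v ` Y"
proof -
  let ?g = "\<lambda>t. v (if t \<in> u ` Y then inv_into Y u t else y0)"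
  have "?g (u y) = v y" if "y \<in> Y" for y
    using that assms(1)[of "inv_into Y u (u y)" y] by (simp add: inv_into_into f_inv_into_f)
  moreover have "range ?g \<subseteq> v ` Y" using assms(2) by (auto simp: inv_into_into)
  ultimately show ?thesis by (intro exI[of _ ?g] conjI ballI)
qed

locale generic_extension =
  fixes k :: nat
  assumes k: "2 \<le> k"
begin

abbreviation R where "R \<equiv> fin_forcing k"

end

sublocale generic_extension \<subseteq> sigma_closed_forcing "fin_forcing k"
  using k by (intro sigma_closed_fin_forcing) simp

context generic_extension
begin

text \<open>The formula \<open>{x. g x \<in> \<tau>} \<in> \<G>\<^sub>k\<close>, in a form that makes sense because names for subsets of a
  countable set are densely decided.\<close>

definition pushforward :: "(nat list \<Rightarrow> 'a) \<Rightarrow> 'a set \<Rightarrow> (nat list set set, 'a) nm \<Rightarrow> nat list set set set" where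
  "pushforward g T \<tau> = {p. \<forall>q. (q, p) \<in> R \<longrightarrow> (\<exists>s D. (s, q) \<in> R \<and> D \<subseteq> T \<and>
     s \<in> feq R \<tau> (chk R D) \<and> below k s {x \<in> omega_pow k. g x \<in> D})}"

lemma pushforwardE:
  assumes "p \<in> pushforward g T \<tau>" "(q, p) \<in> R"
  obtains s D where "(s, q) \<in> R" "D \<subseteq> T" "s \<in> feq R \<tau> (chk R D)" "below k s {x \<in> omega_pow k. g x \<in> D}"
  using assms unfolding pushforward_def by blast

lemma regular_pushforward: "regular (pushforward g T \<tau>)"
proof (rule regularI)
  show "q \<in> pushforward g T \<tau>" if "p \<in> pushforward g T \<tau>" "(q, p) \<in> R" for p q
    using that trans unfolding pushforward_def by blast
  fix p assume dense: "\<And>q. (q, p) \<in> R \<Longrightarrow> \<exists>r. (r, q) \<in> R \<and> r \<in> pushforward g T \<tau>"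
  have "\<exists>s D. (s, q) \<in> R \<and> D \<subseteq> T \<and> s \<in> feq R \<tau> (chk R D) \<and> below k s {x \<in> omega_pow k. g x \<in> D}"
    if q: "(q, p) \<in> R" for q
  proof -
    obtain r where r: "(r, q) \<in> R" "r \<in> pushforward g T \<tau>" using dense q by blast
    obtain s D where s: "(s, r) \<in> R" "D \<subseteq> T" "s \<in> feq R \<tau> (chk R D)" "below k s {x \<in> omega_pow k. g x \<in> D}"
      using r(2) refl[OF FieldI1[OF r(1)]] by (rule pushforwardE)
    show ?thesis using trans[OF s(1) r(1)] s(2-4) by (intro exI[of _ s] exI[of _ D] conjI)
  qed
  then show "p \<in> pushforward g T \<tau>" unfolding pushforward_def by simp
qed

text \<open>Any other ground set to which a stronger condition decides the name must equal
  \<open>D\<close>. So the existential in the definition collapses to a statement about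
  \<open>D\<close>.\<close>

lemma pushforward_decided:
  assumes p: "p \<in> Field R" and D: "D \<subseteq> T" "p \<in> feq R \<tau> (chk R D)"
  shows "p \<in> pushforward g T \<tau> \<longleftrightarrow> below k p {x \<in> omega_pow k. g x \<in> D}"
proof
  assume pf: "p \<in> pushforward g T \<tau>"
  show "below k p {x \<in> omega_pow k. g x \<in> D}"
  proof (rule below_dense[OF p])
    fix q assume q: "(q, p) \<in> R"
    obtain s D' where s: "(s, q) \<in> R" "s \<in> feq R \<tau> (chk R D')" "below k s {x \<in> omega_pow k. g x \<in> D'}"
      using pf q by (rule pushforwardE)
    have "x \<in> D' \<longleftrightarrow> x \<in> D" for x
      using feq_chkD[OF D(2) trans[OF s(1) q], of x] feq_chkD[OF s(2) refl[OF FieldI1[OF s(1)]], of x]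
      by simp
    then show "\<exists>e. (e, q) \<in> R \<and> below k e {x \<in> omega_pow k. g x \<in> D}" using s(1,3) by auto
  qed
next
  assume b: "below k p {x \<in> omega_pow k. g x \<in> D}"
  have "(q, q) \<in> R \<and> D \<subseteq> T \<and> q \<in> feq R \<tau> (chk R D) \<and> below k q {x \<in> omega_pow k. g x \<in> D}"
    if "(q, p) \<in> R" for q
    using refl[OF FieldI1[OF that]] D(1) regularD[OF regular_feq D(2) that] below_trans[OF that b] by simp
  then show "p \<in> pushforward g T \<tau>" unfolding pushforward_def mem_Collect_eq by (intro allI impI exI)
qed

lemma pushforward_fsub:
  assumes "p \<in> pushforward g T \<tau>"
  shows "p \<in> fsub R \<tau> (chk R T)"
  unfolding fsub_iff
proof (intro allI impI)
  fix q x assume q: "(q, p) \<in> R" "q \<in> fmem R x \<tau>"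
  obtain s D where s: "(s, q) \<in> R" "D \<subseteq> T" "s \<in> feq R \<tau> (chk R D)"
    using assms q(1) by (rule pushforwardE)
  have "s \<in> fmem R x \<tau>" using q(2) s(1) by (rule regularD[OF regular_fmem])
  then have "x \<in> T" using feq_chkD[OF s(3) refl[OF FieldI1[OF s(1)]]] s(2) by auto
  then show "q \<in> fmem R x (chk R T)" by (simp add: fmem_chk[OF FieldI1[OF q(1)]])
qed

text \<open>The tool for comparing images of the generic ultrafilter. Below \<open>p\<close> its
  members may be intersected with \<open>Y\<close>, so an implication between the two memberships is
  required only at points of \<open>Y\<close>. Countability of \<open>T'\<close> allows the second
  name to be decided as well.\<close>

lemma pushforward_transfer:
  assumes pf: "p \<in> pushforward g T \<tau>" and p: "p \<in> Field R" and Y: "below k p Y"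
    and T': "countable T'" "p \<in> fsub R \<tau>' (chk R T')"
    and imp: "\<And>q y. (q, p) \<in> R \<Longrightarrow> y \<in> Y \<Longrightarrow> y \<in> omega_pow k \<Longrightarrow> q \<in> fmem R (g y) \<tau> \<Longrightarrow> q \<in> fmem R (g' y) \<tau>'"
  shows "p \<in> pushforward g' T' \<tau>'"
proof (rule regular_dense[OF regular_pushforward p])
  fix q assume q: "(q, p) \<in> R"
  obtain s D where s: "(s, q) \<in> R" "D \<subseteq> T" "s \<in> feq R \<tau> (chk R D)" "below k s {x \<in> omega_pow k. g x \<in> D}"
    using pf q by (rule pushforwardE)
  have sp: "(s, p) \<in> R" using s(1) q by (rule trans)
  obtain t D' where t: "(t, s) \<in> R" "D' \<subseteq> T'" "t \<in> feq R \<tau>' (chk R D')"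
    using decide_countable_name[OF T'(1) regularD[OF regular_fsub T'(2) sp] FieldI1[OF s(1)]] by blast
  have tp: "(t, p) \<in> R" using t(1) sp by (rule trans)
  have tF: "t \<in> Field R" using t(1) by (rule FieldI1)
  have "g' y \<in> D'" if "y \<in> Y" "y \<in> omega_pow k" "g y \<in> D" for y
  proof -
    have "t \<in> fmem R (g y) \<tau>" using feq_chkD[OF s(3) t(1)] that(3) by simp
    then have "t \<in> fmem R (g' y) \<tau>'" by (rule imp[OF tp that(1,2)])
    then show ?thesis using feq_chkD[OF t(3) refl[OF tF]] by simp
  qed
  then have "Y \<inter> {x \<in> omega_pow k. g x \<in> D} \<subseteq> {x \<in> omega_pow k. g' x \<in> D'}" by blast
  moreover have "below k t (Y \<inter> {x \<in> omega_pow k. g x \<in> D})"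
    using below_trans[OF tp Y] below_trans[OF t(1) s(4)] by (rule below_Int[OF tF])
  ultimately have "below k t {x \<in> omega_pow k. g' x \<in> D'}" using below_mono by blast
  then have "t \<in> pushforward g' T' \<tau>'" using pushforward_decided[OF tF t(2,3)] by simp
  then show "\<exists>r. (r, q) \<in> R \<and> r \<in> pushforward g' T' \<tau>'" using trans[OF t(1) s(1)] by blast
qed

text \<open>The generic name contains only canonical names of ground sets, so membership already
  comes with a deciding condition. Conversely, a condition below \<open>D\<close> makes
  \<open>D\<close> positive, and then the class of \<open>D\<close> is itself a condition.\<close>

lemma generic_uf_eq_pushforward:
  assumes p: "p \<in> Field R"
  shows "p \<in> generic_uf k \<tau> \<longleftrightarrow> p \<in> pushforward id (omega_pow k) \<tau>"
proof
  assume L: "p \<in> generic_uf k \<tau>"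
  have "\<exists>s D. (s, q) \<in> R \<and> D \<subseteq> omega_pow k \<and> s \<in> feq R \<tau> (chk R D) \<and> below k s {x \<in> omega_pow k. id x \<in> D}"
    if q: "(q, p) \<in> R" for q
  proof -
    obtain s r \<sigma> where s: "(s, q) \<in> R" "(s, r) \<in> R" "(r, \<sigma>) \<in> generic_name k" "s \<in> feq R \<tau> \<sigma>"
      using L q unfolding generic_uf_def fmem2_def by blast
    then obtain X where X: "r \<in> fin_quotient k" "X \<in> r" "\<sigma> = chk R X"
      unfolding generic_name_def by blast
    have sub: "X \<subseteq> omega_pow k" using X(1,2) mem_cls_iff unfolding fin_quotient_iff by blast
    have "below k r X" using X(2) unfolding below_def by (metis Diff_cancel not_pos_empty)
    then have "below k s X" using s(2) below_trans by blast
    moreover have "{x \<in> omega_pow k. id x \<in> X} = X" using sub by auto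
    ultimately show ?thesis using s(1,4) sub X(3) by (intro exI[of _ s] exI[of _ X]) simp
  qed
  then show "p \<in> pushforward id (omega_pow k) \<tau>" unfolding pushforward_def by simp
next
  assume L: "p \<in> pushforward id (omega_pow k) \<tau>"
  have "\<exists>s r \<sigma>. (s, q) \<in> R \<and> (s, r) \<in> R \<and> (r, \<sigma>) \<in> generic_name k \<and> s \<in> feq R \<tau> \<sigma>"
    if q: "(q, p) \<in> R" for q
  proof -
    obtain s D where s: "(s, q) \<in> R" "D \<subseteq> omega_pow k" "s \<in> feq R \<tau> (chk R D)"
        "below k s {x \<in> omega_pow k. id x \<in> D}"
      using L q by (rule pushforwardE)
    have D: "below k s D" using s(4) by (rule below_mono) auto
    obtain X where X: "X \<subseteq> omega_pow k" "pos k X" "s = cls k X"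
      using FieldI1[OF s(1)] unfolding Field_fin_forcing fin_quotient_iff by blast
    have n: "\<not> pos k (X - D)" using D X by (simp add: below_cls_iff)
    then have pD: "pos k D" using X(2) not_pos_subset_Un[of X D "X - D" k] by blast
    then have "(s, cls k D) \<in> R" using X n s(2) fin_forcing_cls_iff by simp
    moreover have "(cls k D, chk R D) \<in> generic_name k"
      using pD s(2) self_mem_cls[OF s(2)] unfolding generic_name_def fin_quotient_iff by blast
    ultimately show ?thesis using s(1,3) by blast
  qed
  then show "p \<in> generic_uf k \<tau>" unfolding generic_uf_def fmem2_def by simp
qed

lemma generic_uf_chk:
  assumes p: "p \<in> Field R" and X: "X \<subseteq> omega_pow k"
  shows "p \<in> generic_uf k (chk R X) \<longleftrightarrow> below k p X"
proof -
  have "{x \<in> omega_pow k. id x \<in> X} = X" using X by auto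
  then show ?thesis
    using pushforward_decided[OF p X feq_refl, of id] generic_uf_eq_pushforward[OF p] by simp
qed

lemma regular_generic_uf: "regular (generic_uf k \<tau>)"
  unfolding generic_uf_def by (rule regular_fmem2)

lemma regular_in_B: "regular (in_B k X)"
  unfolding in_B_def by (intro regular_fand regular_in_E regular_generic_uf)

lemma nimage_chk: "nimage g (chk R X) = chk R (g ` X)"
  by (auto simp: nimage_def chk_def)

section \<open>Ground trees as members of the space in the extension\<close>

lemma is_E_tree_chk:
  assumes v: "v \<in> Field R" and E: "tree_embedding k E"
  shows "v \<in> is_E_tree R k (chk R ((\<lambda>js. (js, set (E js))) ` nd_le k))" (is "v \<in> is_E_tree R k ?H")
  unfolding is_E_tree_def fand_iff fall_iff
proof (intro conjI allI fimpI)
  have k1: "1 \<le> k" using k by simp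
  have E': "set (E js) \<in> W_hat k" "sorted_wrt (<) (E js)" "length (E js) = length js" if "js \<in> nd_le k" for js
    using E that by (simp_all add: tree_embedding_def)
  show "v \<in> is_function R (nd_le k) (W_hat k) ?H"
    using v E'(1) by (rule is_function_chk_graph)
  have H: "w = set (E js) \<and> js \<in> nd_le k" if "q \<in> fmem R (js, w) ?H" "(q, v) \<in> R" for q js w
    using that(1) by (auto simp: fmem_chk[OF FieldI1[OF that(2)]])
  show "q \<in> gnd (card w = length (nd_nth k m))" if "(q, v) \<in> R" "q \<in> fmem R (nd_nth k m, w) ?H" for q m w
    using H[OF that(2,1)] E'[of "nd_nth k m"] by (simp add: gnd_iff distinct_card strict_sorted_iff)
  show "q \<in> gnd (Max u < Max w)"
    if q: "(q, v) \<in> R" "q \<in> (gnd (1 \<le> m) \<^bold>\<and> fmem R (nd_nth k m, u) ?H \<^bold>\<and> fmem R (nd_nth k (m + 1), w) ?H)" for q m u w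
  proof -
    let ?a = "nd_nth k m" and ?b = "nd_nth k (m + 1)"
    have m: "1 \<le> m" and mem: "q \<in> fmem R (?a, u) ?H" "q \<in> fmem R (?b, w) ?H"
      using q(2) unfolding fand_iff gnd_iff by simp_all
    have u: "u = set (E ?a)" and w: "w = set (E ?b)"
      using H[OF mem(1) q(1)] H[OF mem(2) q(1)] by simp_all
    have ab: "?a \<in> nd_le k" "?b \<in> nd_le k" using k1 by (simp_all add: nd_nth_in_nd_le)
    have prec: "prec ?a ?b" using nd_index_less_iff[OF ab] k1 by (simp add: nd_index_nd_nth)
    \<comment> \<open>Index 0 belongs to the empty sequence, so \<open>m\<close> being at least 1
      excludes the root, which has no last entry.\<close>
    have "prec [] ?a"
    proof -
      have "nd_index k [] = 0" by (simp add: nd_index_def prec_def)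
      then have "?a \<noteq> []" using m nd_index_nd_nth[OF k1, of m] by auto
      then show ?thesis by (simp add: prec_def)
    qed
    then have ne: "?a \<noteq> []" "?b \<noteq> []" using prec by (auto simp: prec_def)
    then have "E ?a \<noteq> []" "E ?b \<noteq> []" using E'(3)[OF ab(1)] E'(3)[OF ab(2)] by auto
    moreover have "last (E ?a) < last (E ?b)" using E ab ne prec by (simp add: tree_embedding_def)
    ultimately show ?thesis
      using Max_strict_sorted[OF E'(2)[OF ab(1)]] Max_strict_sorted[OF E'(2)[OF ab(2)]]
      unfolding gnd_iff u w by simp
  qed
  show "q \<in> gnd (proper_init_seg u w \<longleftrightarrow> strict_prefix (nd_nth k m) (nd_nth k n))"
    if q: "(q, v) \<in> R" "q \<in> (fmem R (nd_nth k m, u) ?H \<^bold>\<and> fmem R (nd_nth k n, w) ?H)" for q m n u w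
  proof -
    have mem: "q \<in> fmem R (nd_nth k m, u) ?H" "q \<in> fmem R (nd_nth k n, w) ?H"
      using q(2) unfolding fand_iff by simp_all
    have h: "u = set (E (nd_nth k m))" "nd_nth k m \<in> nd_le k" "w = set (E (nd_nth k n))" "nd_nth k n \<in> nd_le k"
      using H[OF mem(1) q(1)] H[OF mem(2) q(1)] by simp_all
    show ?thesis
      using proper_init_seg_iff_strict_prefix[OF E'(2)[OF h(2)] E'(2)[OF h(4)]]
        tree_embedding_strict_prefix_iff[OF E h(2,4)]
      unfolding gnd_iff h(1,3) by simp
  qed
qed

lemma in_B_tree:
  assumes E: "tree_embedding k E" and v: "v \<in> Field R" and below: "below k v (E ` nd_eq k)"
  shows "v \<in> in_B k (chk R (set ` E ` nd_eq k))"
proof -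
  let ?H = "chk R ((\<lambda>js. (js, set (E js))) ` nd_le k)"
  have "regular (is_E_tree R k H \<^bold>\<and>
     (\<^bold>\<forall>w. fmem R w X \<^bold>\<longleftrightarrow>\<^bsub>R\<^esub> fex R (\<lambda>js. gnd (js \<in> nd_eq k) \<^bold>\<and> fmem R (js, w) H)))" for H X
    unfolding is_E_tree_def by (intro regular_intros)
  moreover have "v \<in> (is_E_tree R k ?H \<^bold>\<and> (\<^bold>\<forall>w. fmem R w (chk R (set ` E ` nd_eq k)) \<^bold>\<longleftrightarrow>\<^bsub>R\<^esub>
      fex R (\<lambda>js. gnd (js \<in> nd_eq k) \<^bold>\<and> fmem R (js, w) ?H)))"
    unfolding fand_iff fall_iff
  proof (intro conjI allI fiffI is_E_tree_chk[OF v E])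
    fix q w assume "(q, v) \<in> R"
    then have q: "q \<in> Field R" by (rule FieldI1)
    show "q \<in> fmem R w (chk R (set ` E ` nd_eq k)) \<longleftrightarrow>
        q \<in> fex R (\<lambda>js. gnd (js \<in> nd_eq k) \<^bold>\<and> fmem R (js, w) ?H)"
    proof
      assume "q \<in> fmem R w (chk R (set ` E ` nd_eq k))"
      then obtain js where js: "js \<in> nd_eq k" "w = set (E js)" unfolding fmem_chk[OF q] by blast
      then have "js \<in> nd_le k" using nd_eq_subset_nd_le by blast
      then have "q \<in> (gnd (js \<in> nd_eq k) \<^bold>\<and> fmem R (js, w) ?H)"
        using js unfolding fand_iff gnd_iff fmem_chk[OF q] by simp
      then show "q \<in> fex R (\<lambda>js. gnd (js \<in> nd_eq k) \<^bold>\<and> fmem R (js, w) ?H)"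
        by (rule fexI[rotated]) (intro regular_intros)
    next
      assume "q \<in> fex R (\<lambda>js. gnd (js \<in> nd_eq k) \<^bold>\<and> fmem R (js, w) ?H)"
      then obtain r js where r: "(r, q) \<in> R" "r \<in> (gnd (js \<in> nd_eq k) \<^bold>\<and> fmem R (js, w) ?H)"
        using q by (rule fexE)
      then have "js \<in> nd_eq k" "w = set (E js)"
        unfolding fand_iff gnd_iff fmem_chk[OF FieldI1[OF r(1)]] by auto
      then show "q \<in> fmem R w (chk R (set ` E ` nd_eq k))" unfolding fmem_chk[OF q] by blast
    qed
  qed
  ultimately have "v \<in> in_E R k (chk R (set ` E ` nd_eq k))" unfolding in_E_def by (rule fexI)
  moreover have "sorted_list_of_set (set (E js)) = E js" "length (E js) = k" if "js \<in> nd_eq k" for js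
  proof -
    have "js \<in> nd_le k" using that nd_eq_subset_nd_le by blast
    then show "sorted_list_of_set (set (E js)) = E js" "length (E js) = k"
      using E that by (auto simp: tree_embedding_def strict_sorted_iff nd_eq_def
          sorted_list_of_set.idem_if_sorted_distinct)
  qed
  then have "sorted_list_of_set ` set ` E ` nd_eq k = E ` nd_eq k" "E ` nd_eq k \<subseteq> omega_pow k"
    by (auto simp: image_image omega_pow_def intro!: image_cong)
  then have "v \<in> generic_uf k (nimage sorted_list_of_set (chk R (set ` E ` nd_eq k)))"
    using below by (simp add: nimage_chk generic_uf_chk[OF v])
  ultimately show ?thesis unfolding in_B_def fand_iff by simp
qed

text \<open>A point of \<open>X\<close> is the value of a tree at a sequence of length
  \<open>k\<close>. The codomain places it in \<open>W_hat k\<close>, and the cardinality clause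
  gives it \<open>k\<close> elements.\<close>

lemma in_E_subset_W_set:
  assumes X: "p \<in> in_E R k X" and q: "(q, p) \<in> R" "q \<in> fmem R w X"
  shows "w \<in> W_set k"
proof -
  have "q \<in> in_E R k X" using X q(1) by (rule regularD[OF regular_in_E])
  then obtain s H where s: "(s, q) \<in> R" and "s \<in> (is_E_tree R k H \<^bold>\<and>
     (\<^bold>\<forall>w. fmem R w X \<^bold>\<longleftrightarrow>\<^bsub>R\<^esub> fex R (\<lambda>js. gnd (js \<in> nd_eq k) \<^bold>\<and> fmem R (js, w) H)))"
    unfolding in_E_def using FieldI1[OF q(1)] by (rule fexE)
  then have H: "s \<in> fsub R H (chk R (nd_le k \<times> W_hat k))"
      "\<And>m w. s \<in> (fmem R (nd_nth k m, w) H \<^bold>\<longrightarrow>\<^bsub>R\<^esub> gnd (card w = length (nd_nth k m)))"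
      "s \<in> (fmem R w X \<^bold>\<longleftrightarrow>\<^bsub>R\<^esub> fex R (\<lambda>js. gnd (js \<in> nd_eq k) \<^bold>\<and> fmem R (js, w) H))"
    unfolding is_E_tree_def is_function_def fand_iff fall_iff by simp_all
  have sF: "s \<in> Field R" using s by (rule FieldI1)
  have "s \<in> fmem R w X \<longleftrightarrow> s \<in> fex R (\<lambda>js. gnd (js \<in> nd_eq k) \<^bold>\<and> fmem R (js, w) H)"
    using H(3) refl[OF sF] by (rule fiffD) (intro regular_intros)+
  then have "s \<in> fex R (\<lambda>js. gnd (js \<in> nd_eq k) \<^bold>\<and> fmem R (js, w) H)"
    using regularD[OF regular_fmem q(2) s] by simp
  then obtain t js where t: "(t, s) \<in> R" "t \<in> (gnd (js \<in> nd_eq k) \<^bold>\<and> fmem R (js, w) H)"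
    using sF by (rule fexE)
  then have js: "js \<in> nd_eq k" "t \<in> fmem R (js, w) H" unfolding fand_iff gnd_iff by simp_all
  \<comment> \<open>The clauses of an E_k-tree are indexed by positions, so \<open>js\<close> has to
    be written as the entry at its own index.\<close>
  then have nth: "nd_nth k (nd_index k js) = js" using nd_eq_subset_nd_le nd_nth_nd_index by blast
  have "t \<in> gnd (card w = length js)"
    using fimpD[OF H(2) t(1) _ regular_fmem regular_gnd, of "nd_index k js" w] js(2)
    unfolding nth by simp
  moreover have "w \<in> W_hat k" using fsub_chkD[OF H(1) t(1) js(2)] by simp
  ultimately show ?thesis using js(1) unfolding W_set_iff gnd_iff nd_eq_def by simp
qed

text \<open>\<open>filter_gen\<close> quantifies over families given by names, so
  \<open>pushforward\<close> needs a name before it can be one of the filters considered.\<close>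

definition pushforward_name :: "(nat list \<Rightarrow> 'a) \<Rightarrow> 'a set \<Rightarrow> (nat list set set, 'a) fam" where
  "pushforward_name g T = {(c, chk R D) |c D. c \<in> Field R \<and> D \<subseteq> T \<and> below k c {x \<in> omega_pow k. g x \<in> D}}"

lemma fmem2_pushforward_name: "fmem2 R (pushforward_name g T) \<tau> = pushforward g T \<tau>"
proof -
  have "(\<exists>s r \<sigma>. (s, q) \<in> R \<and> (s, r) \<in> R \<and> (r, \<sigma>) \<in> pushforward_name g T \<and> s \<in> feq R \<tau> \<sigma>) \<longleftrightarrow>
    (\<exists>s D. (s, q) \<in> R \<and> D \<subseteq> T \<and> s \<in> feq R \<tau> (chk R D) \<and> below k s {x \<in> omega_pow k. g x \<in> D})"
    (is "?L \<longleftrightarrow> ?M") for q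
  proof
    assume ?L
    then obtain s r \<sigma> where s: "(s, q) \<in> R" "(s, r) \<in> R" "(r, \<sigma>) \<in> pushforward_name g T" "s \<in> feq R \<tau> \<sigma>"
      by (elim exE conjE)
    then obtain D where D: "\<sigma> = chk R D" "D \<subseteq> T" "below k r {x \<in> omega_pow k. g x \<in> D}"
      unfolding pushforward_name_def by blast
    show ?M using s(1,4) D(1,2) below_trans[OF s(2) D(3)] by (intro exI[of _ s] exI[of _ D]) simp
  next
    assume ?M
    then obtain s D where s: "(s, q) \<in> R" "D \<subseteq> T" "s \<in> feq R \<tau> (chk R D)" "below k s {x \<in> omega_pow k. g x \<in> D}"
      by (elim exE conjE)
    have sF: "s \<in> Field R" using s(1) by (rule FieldI1)
    then have "(s, chk R D) \<in> pushforward_name g T" using s(2,4) unfolding pushforward_name_def by blast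
    then show ?L using s(1,3) refl[OF sF] by (intro exI[of _ s] exI[of _ "chk R D"]) simp
  qed
  then show ?thesis unfolding fmem2_def pushforward_def by simp
qed

lemma is_filter_on_pushforward:
  assumes p: "p \<in> Field R" and T: "countable T" "below k p {x \<in> omega_pow k. g x \<in> T}"
  shows "p \<in> is_filter_on R T (pushforward g T)"
  unfolding is_filter_on_def fand_iff fall_iff
proof (intro conjI allI fimpI)
  show "q \<in> fsub R A (chk R T)" if "q \<in> pushforward g T A" for q A
    using that by (rule pushforward_fsub)
  show "p \<in> pushforward g T (chk R T)"
    unfolding pushforward_decided[OF p order_refl feq_refl] by (rule T(2))
  show "p \<in> (\<^bold>\<not>\<^bsub>R\<^esub> pushforward g T (chk R {}))"
    unfolding fneg_iff
  proof (intro allI impI notI)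
    fix q assume q: "(q, p) \<in> R" "q \<in> pushforward g T (chk R {})"
    have qF: "q \<in> Field R" using q(1) by (rule FieldI1)
    have "below k q {x \<in> omega_pow k. g x \<in> {}}"
      using q(2) unfolding pushforward_decided[OF qF empty_subsetI feq_refl] .
    then show False using not_below_empty[OF qF] by simp
  qed
  show "q \<in> pushforward g T B"
    if q: "(q, p) \<in> R" "q \<in> (pushforward g T A \<^bold>\<and> fsub R A B \<^bold>\<and> fsub R B (chk R T))" for q A B
  proof -
    have AB: "q \<in> pushforward g T A" "q \<in> fsub R A B" "q \<in> fsub R B (chk R T)"
      using q(2) unfolding fand_iff by simp_all
    show ?thesis
    proof (rule pushforward_transfer[OF AB(1) FieldI1[OF q(1)] below_trans[OF q(1) T(2)] T(1) AB(3)])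
      fix r y assume "(r, q) \<in> R" "r \<in> fmem R (g y) A"
      then show "r \<in> fmem R (g y) B" using AB(2) unfolding fsub_iff by simp
    qed
  qed
  show "q \<in> pushforward g T C"
    if q: "(q, p) \<in> R" "q \<in> (pushforward g T A \<^bold>\<and> pushforward g T B \<^bold>\<and>
      (\<^bold>\<forall>x. fmem R x C \<^bold>\<longleftrightarrow>\<^bsub>R\<^esub> (fmem R x A \<^bold>\<and> fmem R x B)))" for q A B C
  proof (rule regular_dense[OF regular_pushforward FieldI1[OF q(1)]])
    have A: "q \<in> pushforward g T A" and B: "q \<in> pushforward g T B"
      and C: "\<And>x. q \<in> (fmem R x C \<^bold>\<longleftrightarrow>\<^bsub>R\<^esub> (fmem R x A \<^bold>\<and> fmem R x B))"
      using q(2) unfolding fand_iff fall_iff by simp_all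
    fix r assume r: "(r, q) \<in> R"
    obtain s D where s: "(s, r) \<in> R" "D \<subseteq> T" "s \<in> feq R A (chk R D)" "below k s {x \<in> omega_pow k. g x \<in> D}"
      using A r by (rule pushforwardE)
    obtain t D' where t: "(t, s) \<in> R" "D' \<subseteq> T" "t \<in> feq R B (chk R D')" "below k t {x \<in> omega_pow k. g x \<in> D'}"
      using B trans[OF s(1) r] by (rule pushforwardE)
    have tq: "(t, q) \<in> R" using t(1) trans[OF s(1) r] by (rule trans)
    have tF: "t \<in> Field R" using t(1) by (rule FieldI1)
    have "u \<in> fmem R x C \<longleftrightarrow> u \<in> fmem R x (chk R (D \<inter> D'))" if u: "(u, t) \<in> R" for u x
    proof -
      have "u \<in> fmem R x C \<longleftrightarrow> u \<in> (fmem R x A \<^bold>\<and> fmem R x B)"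
        using C trans[OF u tq] by (rule fiffD) (intro regular_intros)+
      then show ?thesis
        unfolding fand_iff feq_chkD[OF s(3) trans[OF u t(1)]] feq_chkD[OF t(3) u]
          fmem_chk[OF FieldI1[OF u]] by simp
    qed
    then have "t \<in> feq R C (chk R (D \<inter> D'))" unfolding feq_iff by simp
    then have "t \<in> pushforward g T C \<longleftrightarrow> below k t {x \<in> omega_pow k. g x \<in> D \<inter> D'}"
      using s(2) by (intro pushforward_decided[OF tF]) auto
    moreover have "below k t {x \<in> omega_pow k. g x \<in> D \<inter> D'}"
      using below_Int[OF tF below_trans[OF t(1) s(4)] t(4)] by (rule below_mono) blast
    ultimately have "t \<in> pushforward g T C" by simp
    then show "\<exists>t. (t, r) \<in> R \<and> t \<in> pushforward g T C" using trans[OF t(1) s(1)] by blast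
  qed
qed

section \<open>Projections of members of B_k and the filter they generate\<close>

abbreviation proj :: "nat \<Rightarrow> nat list \<Rightarrow> nat set" where
  "proj l x \<equiv> pi_proj l (set x)"

abbreviation proj_W :: "nat \<Rightarrow> nat set set" where
  "proj_W l \<equiv> pi_proj l ` W_set k"

lemma countable_proj_W: "countable (proj_W l)"
  unfolding W_set_def by (intro countable_image) (rule countableI_type)

lemma set_in_W_set: "x \<in> code_set k \<Longrightarrow> set x \<in> W_set k"
  unfolding code_set_eq W_set_def using set_code by blast

lemma code_set_subset_proj: "code_set k \<subseteq> {x \<in> omega_pow k. proj l x \<in> proj_W l}"
  using set_in_W_set code_set_subset by blast

definition base :: "nat \<Rightarrow> (nat list set set, nat set) nm \<Rightarrow> nat list set set set" where
  "base l C = fex R (\<lambda>X. in_B k X \<^bold>\<and> feq R C (nimage (pi_proj l) X))"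

lemma regular_base: "regular (base l C)"
  unfolding base_def by (intro regular_fex regular_fand regular_in_B regular_feq)

lemma pi_generic_eq_filter_gen: "pi_generic k l \<tau> = filter_gen R (proj_W l) (base l) \<tau>"
  unfolding pi_generic_def base_def by simp

lemma regular_pi_generic: "regular (pi_generic k l \<tau>)"
  unfolding pi_generic_eq_filter_gen by (intro regular_filter_gen regular_base)

text \<open>The enumerations of the members of \<open>X\<close> form a set in the generic
  ultrafilter, and \<open>proj l\<close> maps them into \<open>C\<close>. So
  \<open>pushforward_transfer\<close> applies, with all lists as \<open>Y\<close>.\<close>

lemma base_imp_pushforward:
  assumes p: "p \<in> Field R" and C: "p \<in> base l C"
  shows "p \<in> pushforward (proj l) (proj_W l) C"
proof (rule regular_dense[OF regular_pushforward p])
  fix q assume q: "(q, p) \<in> R"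
  have "q \<in> base l C" using C q by (rule regularD[OF regular_base])
  then obtain r X where r: "(r, q) \<in> R" and "r \<in> (in_B k X \<^bold>\<and> feq R C (nimage (pi_proj l) X))"
    unfolding base_def using FieldI1[OF q] by (rule fexE)
  then have X: "r \<in> in_E R k X" "r \<in> generic_uf k (nimage sorted_list_of_set X)"
    "r \<in> feq R C (nimage (pi_proj l) X)"
    unfolding in_B_def fand_iff by simp_all
  have rF: "r \<in> Field R" using r by (rule FieldI1)
  have C_iff: "s \<in> fmem R x C \<longleftrightarrow> (\<forall>t. (t, s) \<in> R \<longrightarrow> (\<exists>u w. (u, t) \<in> R \<and> pi_proj l w = x \<and> u \<in> fmem R w X))"
    if "(s, r) \<in> R" for s x
    using X(3) that unfolding feq_iff fmem_nimage by simp
  have sub: "r \<in> fsub R C (chk R (proj_W l))"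
    unfolding fsub_iff
  proof (intro allI impI)
    fix s x assume s: "(s, r) \<in> R" "s \<in> fmem R x C"
    have sF: "s \<in> Field R" using s(1) by (rule FieldI1)
    obtain u w where u: "(u, s) \<in> R" "pi_proj l w = x" "u \<in> fmem R w X"
      using s(2) refl[OF sF] unfolding C_iff[OF s(1)] by meson
    have "w \<in> W_set k" using X(1) trans[OF u(1) s(1)] u(3) by (rule in_E_subset_W_set)
    then show "s \<in> fmem R x (chk R (proj_W l))" using u(2) unfolding fmem_chk[OF sF] by blast
  qed
  have "r \<in> pushforward id (omega_pow k) (nimage sorted_list_of_set X)"
    using X(2) generic_uf_eq_pushforward[OF rF] by simp
  then have "r \<in> pushforward (proj l) (proj_W l) C"
  proof (rule pushforward_transfer[OF _ rF _ countable_proj_W sub])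
    show "below k r UNIV"
      using rF unfolding Field_fin_forcing fin_quotient_iff by (auto simp: below_cls_iff)
    fix s y assume s: "(s, r) \<in> R" and y: "y \<in> omega_pow k" "s \<in> fmem R (id y) (nimage sorted_list_of_set X)"
    show "s \<in> fmem R (proj l y) C"
      unfolding C_iff[OF s]
    proof (intro allI impI)
      fix t assume "(t, s) \<in> R"
      then obtain u w where u: "(u, t) \<in> R" "sorted_list_of_set w = y" "u \<in> fmem R w X"
        using y(2) unfolding fmem_nimage by auto
      \<comment> \<open>\<open>sorted_list_of_set\<close> returns \<open>[]\<close> on infinite
        sets. A nonempty \<open>y\<close> therefore shows that \<open>w\<close> is finite and
        recoverable from its enumeration.\<close>
      have "y \<noteq> []" using y(1) k by (auto simp: omega_pow_def)
      then have "finite w" using u(2) sorted_list_of_set.fold_insort_key.infinite by blast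
      then have "set y = w" using u(2) by auto
      then show "\<exists>u w. (u, t) \<in> R \<and> pi_proj l w = proj l y \<and> u \<in> fmem R w X" using u(1,3) by blast
    qed
  qed
  then show "\<exists>r. (r, q) \<in> R \<and> r \<in> pushforward (proj l) (proj_W l) C" using r by blast
qed

text \<open>Once the name is decided to be \<open>D\<close>, some positive set of tuples in
  \<open>code_set k\<close> projects into \<open>D\<close>, and it contains the top level of a
  positive tree. The class of that level is the new condition, which forces the tree to be in
  B_k.\<close>

lemma pushforward_imp_base_subset:
  assumes p: "p \<in> Field R" "below k p (code_set k)" and \<tau>: "p \<in> pushforward (proj l) (proj_W l) \<tau>"
  shows "\<exists>q C. (q, p) \<in> R \<and> q \<in> base l C \<and> q \<in> fsub R C \<tau>"
proof -
  obtain s D where s: "(s, p) \<in> R" "D \<subseteq> proj_W l" "s \<in> feq R \<tau> (chk R D)"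
      "below k s {x \<in> omega_pow k. proj l x \<in> D}"
    using \<tau> refl[OF p(1)] by (rule pushforwardE)
  have sF: "s \<in> Field R" using s(1) by (rule FieldI1)
  obtain Y where Y: "Y \<subseteq> {x \<in> omega_pow k. proj l x \<in> D} \<inter> code_set k" "Y \<subseteq> omega_pow k" "pos k Y"
      "\<And>Z. Z \<subseteq> Y \<Longrightarrow> pos k Z \<Longrightarrow> (cls k Z, s) \<in> R"
    using below_imp_positive_subset[OF sF below_Int[OF sF s(4) below_trans[OF s(1) p(2)]]] by auto
  have "1 \<le> k" "Y \<subseteq> code_set k" using k Y(1) by auto
  then obtain E where E: "tree_embedding k E" "E ` nd_eq k \<subseteq> Y" "pos k (E ` nd_eq k)"
    using positive_tree_embedding Y(3) by blast
  define v where "v = cls k (E ` nd_eq k)"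
  have vs: "(v, s) \<in> R" unfolding v_def using E(2,3) by (rule Y(4))
  have vF: "v \<in> Field R" using vs by (rule FieldI1)
  have "E ` nd_eq k \<subseteq> omega_pow k" using E(2) Y(2) by blast
  then have "below k v (E ` nd_eq k)" unfolding v_def by (simp add: below_cls_iff)
  then have B: "v \<in> in_B k (chk R (set ` E ` nd_eq k))" by (rule in_B_tree[OF E(1) vF])
  let ?C = "chk R (pi_proj l ` set ` E ` nd_eq k)"
  have "v \<in> (in_B k (chk R (set ` E ` nd_eq k)) \<^bold>\<and> feq R ?C (nimage (pi_proj l) (chk R (set ` E ` nd_eq k))))"
    using B unfolding fand_iff nimage_chk by (simp add: feq_refl)
  then have "v \<in> base l ?C"
    unfolding base_def by (rule fexI[rotated]) (intro regular_fand regular_in_B regular_feq)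
  moreover have "v \<in> fsub R ?C \<tau>"
    unfolding fsub_iff
  proof (intro allI impI)
    fix r x assume r: "(r, v) \<in> R" "r \<in> fmem R x ?C"
    then have "x \<in> pi_proj l ` set ` E ` nd_eq k" by (simp only: fmem_chk[OF FieldI1[OF r(1)]])
    then have "x \<in> D" using E(2) Y(1) by blast
    then show "r \<in> fmem R x \<tau>" unfolding feq_chkD[OF s(3) trans[OF r(1) vs]] .
  qed
  ultimately show ?thesis using trans[OF vs s(1)] by (intro exI[of _ v] exI[of _ ?C] conjI)
qed

text \<open>The image of the generic ultrafilter is itself a filter containing the base, so the
  generated filter lies inside it. Conversely, each of its members densely includes a member of the
  base, so it belongs to every filter containing the base.\<close>

lemma pi_generic_eq_pushforward:
  assumes p: "p \<in> Field R" "below k p (code_set k)"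
  shows "p \<in> pi_generic k l \<tau> \<longleftrightarrow> p \<in> pushforward (proj l) (proj_W l) \<tau>"
proof
  assume L: "p \<in> pi_generic k l \<tau>"
  let ?F = "pushforward_name (proj l) (proj_W l)"
  have F: "fmem2 R ?F = pushforward (proj l) (proj_W l)" by (rule ext) (rule fmem2_pushforward_name)
  have "p \<in> ((is_filter_on R (proj_W l) (fmem2 R ?F) \<^bold>\<and> (\<^bold>\<forall>C. base l C \<^bold>\<longrightarrow>\<^bsub>R\<^esub> fmem2 R ?F C))
         \<^bold>\<longrightarrow>\<^bsub>R\<^esub> fmem2 R ?F \<tau>)"
    using L unfolding pi_generic_eq_filter_gen filter_gen_def fand_iff fall_iff by simp
  moreover have "p \<in> (is_filter_on R (proj_W l) (fmem2 R ?F) \<^bold>\<and> (\<^bold>\<forall>C. base l C \<^bold>\<longrightarrow>\<^bsub>R\<^esub> fmem2 R ?F C))"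
    unfolding fand_iff fall_iff F
  proof (intro conjI allI fimpI)
    have "below k p {x \<in> omega_pow k. proj l x \<in> proj_W l}"
      using p(2) code_set_subset_proj by (rule below_mono)
    then show "p \<in> is_filter_on R (proj_W l) (pushforward (proj l) (proj_W l))"
      by (rule is_filter_on_pushforward[OF p(1) countable_proj_W])
    show "q \<in> pushforward (proj l) (proj_W l) C" if "(q, p) \<in> R" "q \<in> base l C" for q C
      using FieldI1[OF that(1)] that(2) by (rule base_imp_pushforward)
  qed
  ultimately have "p \<in> fmem2 R ?F \<tau>"
    by (rule fimpD[OF _ refl[OF p(1)]])
      (intro regular_fand regular_is_filter_on regular_fmem2 regular_fall regular_fimp regular_base)+
  then show "p \<in> pushforward (proj l) (proj_W l) \<tau>" unfolding F .
next
  assume L: "p \<in> pushforward (proj l) (proj_W l) \<tau>"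
  show "p \<in> pi_generic k l \<tau>"
    unfolding pi_generic_eq_filter_gen filter_gen_def fand_iff fall_iff
  proof (intro conjI allI fimpI)
    show sub: "p \<in> fsub R \<tau> (chk R (proj_W l))" using L by (rule pushforward_fsub)
    fix F q
    assume q: "(q, p) \<in> R"
      and "q \<in> (is_filter_on R (proj_W l) (fmem2 R F) \<^bold>\<and> (\<^bold>\<forall>C. base l C \<^bold>\<longrightarrow>\<^bsub>R\<^esub> fmem2 R F C))"
    then have fil: "q \<in> is_filter_on R (proj_W l) (fmem2 R F)"
      and base: "\<And>C. q \<in> (base l C \<^bold>\<longrightarrow>\<^bsub>R\<^esub> fmem2 R F C)"
      unfolding fand_iff fall_iff by simp_all
    show "q \<in> fmem2 R F \<tau>"
    proof (rule regular_dense[OF regular_fmem2 FieldI1[OF q]])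
      fix r assume r: "(r, q) \<in> R"
      have rp: "(r, p) \<in> R" using r q by (rule trans)
      obtain v C where v: "(v, r) \<in> R" "v \<in> base l C" "v \<in> fsub R C \<tau>"
        using pushforward_imp_base_subset[OF FieldI1[OF r] below_trans[OF rp p(2)]
            regularD[OF regular_pushforward L rp]] by (elim exE conjE)
      have vq: "(v, q) \<in> R" using v(1) r by (rule trans)
      have "v \<in> fmem2 R F C" using base vq v(2) regular_base regular_fmem2 by (rule fimpD)
      then have "v \<in> fmem2 R F \<tau>"
        using v(3) regularD[OF regular_fsub sub trans[OF v(1) rp]]
        by (rule filter_upward[OF fil regular_fmem2 vq])
      then show "\<exists>v. (v, r) \<in> R \<and> v \<in> fmem2 R F \<tau>" using v(1) by blast
    qed
  qed
qed

text \<open>Codes are strictly increasing, so the set of the first \<open>l\<close> entries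
  determines the list of them. This links the lists used in canonization to the finite sets used in
  the projections.\<close>

lemma proj_eq_iff:
  assumes "x \<in> code_set k" "y \<in> code_set k"
  shows "proj l x = proj l y \<longleftrightarrow> take l x = take l y"
proof -
  have strict: "sorted_wrt (<) z" "sorted_list_of_set (set z) = z" if z: "z \<in> code_set k" for z
  proof -
    obtain js where "js \<in> nd_le k" "z = code k js" using z nd_eq_subset_nd_le unfolding code_set_eq by blast
    then show s: "sorted_wrt (<) z" by (simp add: sorted_code)
    then show "sorted_list_of_set (set z) = z"
      by (simp add: strict_sorted_iff sorted_list_of_set.idem_if_sorted_distinct)
  qed
  have "set (take l x) = set (take l y) \<longleftrightarrow> take l x = take l y"
    using strict(1)[OF assms(1)] strict(1)[OF assms(2)] sorted_wrt_take strict_sorted_equal by metis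
  then show ?thesis by (simp add: pi_proj_def strict(2) assms)
qed

text \<open>On a positive set \<open>Y\<close> where the decided reduction \<open>f\<close> and
  \<open>proj l\<close> have the same fibres, each of them factors through the other. The two factor
  maps \<open>g\<close> and \<open>g'\<close> witness the equivalence.\<close>

lemma rk_below_generic:
  fixes V :: "(nat list set set, 'b) nm \<Rightarrow> nat list set set set"
  assumes p: "p \<in> Field R" "below k p (code_set k)"
    and reg: "\<And>A. regular (V A)"
    and le: "p \<in> rk_le R S V (omega_pow k) (generic_uf k)"
  shows "\<exists>q l. (q, p) \<in> R \<and> l \<le> k \<and> q \<in> rk_equiv R S V (proj_W l) (pi_generic k l)"
proof -
  obtain p1 h where p1: "(p1, p) \<in> R" "p1 \<in> is_function R (omega_pow k) S h"
    and V: "\<forall>r A P. (r, p1) \<in> R \<longrightarrow> r \<in> fsub R A (chk R S) \<longrightarrow>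
       (\<forall>s x. (s, r) \<in> R \<longrightarrow> (s \<in> fmem R x P \<longleftrightarrow> s \<in> fex R (\<lambda>y. fmem R (x, y) h \<^bold>\<and> fmem R y A))) \<longrightarrow>
       (r \<in> V A \<longleftrightarrow> r \<in> generic_uf k P)"
    by (rule rk_leE[OF le p(1) reg regular_generic_uf])
  obtain p2 f where p2: "(p2, p1) \<in> R" and "\<forall>x\<in>omega_pow k. f x \<in> S \<and> p2 \<in> fmem R (x, f x) h"
    using decide_function[OF countableI_type p1(2) FieldI1[OF p1(1)]] by (elim exE conjE)
  then have f: "f x \<in> S \<and> p2 \<in> fmem R (x, f x) h" if "x \<in> omega_pow k" for x
    using that by simp
  have p2p: "(p2, p) \<in> R" using p2 p1(1) by (rule trans)
  obtain Y0 where Y0: "Y0 \<subseteq> code_set k" "Y0 \<subseteq> omega_pow k" "pos k Y0"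
      "\<And>Z. Z \<subseteq> Y0 \<Longrightarrow> pos k Z \<Longrightarrow> (cls k Z, p2) \<in> R"
    using below_imp_positive_subset[OF FieldI1[OF p2] below_trans[OF p2p p(2)]] by auto
  obtain Y l where Y: "Y \<subseteq> Y0" "l \<le> k" "pos k Y" "canonical_on l f Y"
    using canonization[OF Y0(3), of f] by (elim exE conjE)
  define r where "r = cls k Y"
  have r: "(r, p2) \<in> R" unfolding r_def using Y(1,3) by (rule Y0(4))
  have rF: "r \<in> Field R" using r by (rule FieldI1)
  have Y_code: "Y \<subseteq> code_set k" and Y_pow: "Y \<subseteq> omega_pow k" using Y(1) Y0(1,2) by blast+
  have r_below: "below k r Y" unfolding r_def by (simp add: below_cls_iff[OF Y_pow])
  have key: "f x = f y \<longleftrightarrow> proj l x = proj l y" if "x \<in> Y" "y \<in> Y" for x y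
    using Y(4) that proj_eq_iff Y_code unfolding canonical_on_def by blast
  obtain y0 where y0: "y0 \<in> Y" using pos_nonempty[OF Y(3)] by blast

  \<comment> \<open>A name for the preimage of \<open>A\<close> under \<open>f\<close>. It names a
    subset of omega^k, so it can be decided even if \<open>S\<close> is uncountable.\<close>
  define pre where "pre A = {(c, x). c \<in> Field R \<and> x \<in> omega_pow k \<and> c \<in> fmem R (f x) A}"
    for A :: "(nat list set set, 'b) nm"
  have fmem_pre: "s \<in> fmem R x (pre A) \<longleftrightarrow> x \<in> omega_pow k \<and> s \<in> fmem R (f x) A" if "s \<in> Field R" for s x A
    unfolding pre_def using that regular_fmem by (rule fmem_collect)
  have sub_pre: "s \<in> fsub R (pre A) (chk R (omega_pow k))" for s A
    unfolding fsub_iff using fmem_pre fmem_chk by (metis FieldI1)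
  have V_iff: "s \<in> V A \<longleftrightarrow> s \<in> pushforward id (omega_pow k) (pre A)"
    if s: "(s, r) \<in> R" "s \<in> fsub R A (chk R S)" for s A
  proof -
    have s1: "(s, p1) \<in> R" using trans[OF s(1) r] p2 by (rule trans)
    have "s \<in> V A \<longleftrightarrow> s \<in> generic_uf k (pre A)"
    proof (rule V[rule_format, OF s1 s(2)])
      fix t x assume t: "(t, s) \<in> R"
      have tF: "t \<in> Field R" using t by (rule FieldI1)
      have tp2: "(t, p2) \<in> R" using trans[OF t s(1)] r by (rule trans)
      have "t \<in> fex R (\<lambda>y. fmem R (x, y) h \<^bold>\<and> fmem R y A) \<longleftrightarrow> x \<in> omega_pow k \<and> t \<in> fmem R (f x) A"
      proof (rule fex_decided_function[OF tF])
        show "t \<in> is_function R (omega_pow k) S h"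
          using p1(2) trans[OF tp2 p2] by (rule regularD[OF regular_is_function])
        show "t \<in> fmem R (x, f x) h" if "x \<in> omega_pow k" for x
          using conjunct2[OF f[OF that]] tp2 by (rule regularD[OF regular_fmem])
      qed
      then show "t \<in> fmem R x (pre A) \<longleftrightarrow> t \<in> fex R (\<lambda>y. fmem R (x, y) h \<^bold>\<and> fmem R y A)"
        unfolding fmem_pre[OF tF] by simp
    qed
    then show ?thesis using generic_uf_eq_pushforward[OF FieldI1[OF s(1)]] by simp
  qed
  have pi_iff: "s \<in> pi_generic k l A \<longleftrightarrow> s \<in> pushforward (proj l) (proj_W l) A" if s: "(s, r) \<in> R" for s A
  proof (rule pi_generic_eq_pushforward[OF FieldI1[OF s]])
    show "below k s (code_set k)" using below_trans[OF s r_below] Y_code by (rule below_mono)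
  qed
  \<comment> \<open>A name over omega^k and a name over the projections are equivalent as soon as
    they agree along \<open>Y\<close>, by transferring in both directions.\<close>
  have transfer: "s \<in> pushforward id (omega_pow k) \<sigma> \<longleftrightarrow> s \<in> pushforward (proj l) (proj_W l) \<tau>"
    if s: "(s, r) \<in> R" and sub: "s \<in> fsub R \<sigma> (chk R (omega_pow k))" "s \<in> fsub R \<tau> (chk R (proj_W l))"
      and mem: "\<And>t y. (t, s) \<in> R \<Longrightarrow> y \<in> Y \<Longrightarrow> t \<in> fmem R y \<sigma> \<longleftrightarrow> t \<in> fmem R (proj l y) \<tau>"
    for s \<sigma> \<tau>
  proof
    have sF: "s \<in> Field R" and b: "below k s Y" using s FieldI1 below_trans[OF s r_below] by metis+
    show "s \<in> pushforward (proj l) (proj_W l) \<tau>" if "s \<in> pushforward id (omega_pow k) \<sigma>"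
      using that sF b countable_proj_W sub(2) by (rule pushforward_transfer) (simp add: mem)
    show "s \<in> pushforward id (omega_pow k) \<sigma>" if "s \<in> pushforward (proj l) (proj_W l) \<tau>"
      using that sF b countableI_type sub(1) by (rule pushforward_transfer) (simp add: mem)
  qed

  have "\<exists>g. (\<forall>y\<in>Y. g (proj l y) = f y) \<and> range g \<subseteq> f ` Y"
    by (rule factor_through[OF _ y0]) (simp add: key)
  then obtain g where g: "\<forall>y\<in>Y. g (proj l y) = f y" and g_Y: "range g \<subseteq> f ` Y" by (elim exE conjE)
  have g_S: "g t \<in> S" for t
  proof -
    obtain y where "y \<in> Y" "g t = f y" using subsetD[OF g_Y rangeI, of t] by (elim imageE)
    then show ?thesis using f[of y] subsetD[OF Y_pow, of y] by simp
  qed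
  have "\<exists>g. (\<forall>y\<in>Y. g (f y) = proj l y) \<and> range g \<subseteq> proj l ` Y"
    by (rule factor_through[OF _ y0]) (simp add: key)
  then obtain g' where g': "\<forall>y\<in>Y. g' (f y) = proj l y" and g'_Y: "range g' \<subseteq> proj l ` Y" by (elim exE conjE)
  have g'_W: "g' s \<in> proj_W l" for s
  proof -
    obtain y where "y \<in> Y" "g' s = proj l y" using subsetD[OF g'_Y rangeI, of s] by (elim imageE)
    then show ?thesis using set_in_W_set subsetD[OF Y_code, of y] by simp
  qed

  have "r \<in> rk_le R S V (proj_W l) (pi_generic k l)"
  proof (rule rk_leI[OF rF is_function_chk_graph[OF rF g_S] reg regular_pi_generic])
    fix q A P
    assume q: "(q, r) \<in> R" and A: "q \<in> fsub R A (chk R S)"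
      and "\<And>s x. (s, q) \<in> R \<Longrightarrow> s \<in> fmem R x P \<longleftrightarrow>
        s \<in> fex R (\<lambda>y. fmem R (x, y) (chk R ((\<lambda>x. (x, g x)) ` proj_W l)) \<^bold>\<and> fmem R y A)"
    then have P: "s \<in> fmem R x P \<longleftrightarrow> x \<in> proj_W l \<and> s \<in> fmem R (g x) A" if "(s, q) \<in> R" for s x
      using fex_chk_graph[OF FieldI1[OF that]] that by simp
    have "q \<in> fsub R P (chk R (proj_W l))"
      unfolding fsub_iff using P by (simp add: fmem_chk FieldI1)
    then have "q \<in> pushforward id (omega_pow k) (pre A) \<longleftrightarrow> q \<in> pushforward (proj l) (proj_W l) P"
    proof (rule transfer[OF q sub_pre])
      fix t y assume t: "(t, q) \<in> R" and y: "y \<in> Y"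
      have "proj l y \<in> proj_W l" "y \<in> omega_pow k" using y Y_code Y_pow set_in_W_set by blast+
      then show "t \<in> fmem R y (pre A) \<longleftrightarrow> t \<in> fmem R (proj l y) P"
        unfolding fmem_pre[OF FieldI1[OF t]] P[OF t] bspec[OF g y] by simp
    qed
    then show "q \<in> V A \<longleftrightarrow> q \<in> pi_generic k l P" unfolding V_iff[OF q A] pi_iff[OF q] .
  qed
  moreover have "r \<in> rk_le R (proj_W l) (pi_generic k l) S V"
  proof (rule rk_leI[OF rF is_function_chk_graph[OF rF g'_W] regular_pi_generic reg])
    fix q A P
    assume q: "(q, r) \<in> R" and A: "q \<in> fsub R A (chk R (proj_W l))"
      and "\<And>s x. (s, q) \<in> R \<Longrightarrow> s \<in> fmem R x P \<longleftrightarrow>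
        s \<in> fex R (\<lambda>y. fmem R (x, y) (chk R ((\<lambda>x. (x, g' x)) ` S)) \<^bold>\<and> fmem R y A)"
    then have P: "s \<in> fmem R x P \<longleftrightarrow> x \<in> S \<and> s \<in> fmem R (g' x) A" if "(s, q) \<in> R" for s x
      using fex_chk_graph[OF FieldI1[OF that]] that by simp
    have PS: "q \<in> fsub R P (chk R S)"
      unfolding fsub_iff using P by (simp add: fmem_chk FieldI1)
    \<comment> \<open>Since \<open>g'\<close> sends \<open>f y\<close> to \<open>proj l y\<close>,
      the preimage of \<open>P\<close> under \<open>f\<close> agrees on \<open>Y\<close> with that
      of \<open>A\<close> under \<open>proj l\<close>.\<close>
    have "q \<in> pushforward id (omega_pow k) (pre P) \<longleftrightarrow> q \<in> pushforward (proj l) (proj_W l) A"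
    proof (rule transfer[OF q sub_pre A])
      fix t y assume t: "(t, q) \<in> R" and y: "y \<in> Y"
      have "y \<in> omega_pow k" using y Y_pow by blast
      then show "t \<in> fmem R y (pre P) \<longleftrightarrow> t \<in> fmem R (proj l y) A"
        using f unfolding fmem_pre[OF FieldI1[OF t]] P[OF t] bspec[OF g' y] by simp
    qed
    then show "q \<in> pi_generic k l A \<longleftrightarrow> q \<in> V P" unfolding V_iff[OF q PS] pi_iff[OF q] by simp
  qed
  ultimately have "r \<in> rk_equiv R S V (proj_W l) (pi_generic k l)" unfolding rk_equiv_def fand_iff by simp
  then show ?thesis using trans[OF r p2p] Y(2) by (intro exI[of _ r] exI[of _ l] conjI)
qed

end

theorem theorem40:
  fixes k :: nat and S :: "'b set"
  assumes "k \<ge> 2"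
  shows "let R = fin_forcing k in
    forced R (W_in_generic k \<^bold>\<longrightarrow>\<^bsub>R\<^esub>
      (\<^bold>\<forall>V. (is_ultrafilter_on R S (fmem2 R V) \<^bold>\<and> is_nonprincipal_on R S (fmem2 R V) \<^bold>\<and>
             rk_le R S (fmem2 R V) (omega_pow k) (generic_uf k))
         \<^bold>\<longrightarrow>\<^bsub>R\<^esub> fex R (\<lambda>l. gnd (l \<le> k) \<^bold>\<and>
               rk_equiv R S (fmem2 R V) (pi_proj l ` W_set k) (pi_generic k l))))"
proof -
  interpret generic_extension k using assms by unfold_locales
  have reg_le: "regular (rk_le R S (fmem2 R V) (omega_pow k) (generic_uf k))" for V
    unfolding rk_le_def by (intro regular_intros regular_generic_uf)
  show ?thesis
    unfolding Let_def forced_def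
  proof (intro ballI fimpI)
    fix p q assume q: "(q, p) \<in> R" "q \<in> W_in_generic k"
    \<comment> \<open>The assumption on the generic ultrafilter becomes a ground statement about the
      condition, which all stronger conditions inherit.\<close>
    have W: "below k q (code_set k)"
      using q(2) generic_uf_chk[OF FieldI1[OF q(1)] code_set_subset]
      unfolding W_in_generic_def code_set_def by simp
    show "q \<in> (\<^bold>\<forall>V. (is_ultrafilter_on R S (fmem2 R V) \<^bold>\<and> is_nonprincipal_on R S (fmem2 R V) \<^bold>\<and>
             rk_le R S (fmem2 R V) (omega_pow k) (generic_uf k))
         \<^bold>\<longrightarrow>\<^bsub>R\<^esub> fex R (\<lambda>l. gnd (l \<le> k) \<^bold>\<and>
               rk_equiv R S (fmem2 R V) (pi_proj l ` W_set k) (pi_generic k l)))"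
      unfolding fall_iff
    proof (intro allI fimpI)
      fix V r
      assume r: "(r, q) \<in> R" and "r \<in> (is_ultrafilter_on R S (fmem2 R V) \<^bold>\<and>
        is_nonprincipal_on R S (fmem2 R V) \<^bold>\<and> rk_le R S (fmem2 R V) (omega_pow k) (generic_uf k))"
      then have le: "r \<in> rk_le R S (fmem2 R V) (omega_pow k) (generic_uf k)"
        unfolding fand_iff by simp
      show "r \<in> fex R (\<lambda>l. gnd (l \<le> k) \<^bold>\<and>
               rk_equiv R S (fmem2 R V) (pi_proj l ` W_set k) (pi_generic k l))"
        unfolding fex_iff
      proof (intro allI impI)
        \<comment> \<open>The exponent may differ from one strengthening to another, so a witness is
          produced below every \<open>s\<close> instead of one for \<open>r\<close>.\<close>
        fix s assume s: "(s, r) \<in> R"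
        obtain t l where "(t, s) \<in> R" "l \<le> k"
            "t \<in> rk_equiv R S (fmem2 R V) (pi_proj l ` W_set k) (pi_generic k l)"
          using rk_below_generic[OF FieldI1[OF s] below_trans[OF trans[OF s r] W] regular_fmem2
              regularD[OF reg_le le s]]
          by (elim exE conjE)
        then show "\<exists>t l. (t, s) \<in> R \<and> t \<in> (gnd (l \<le> k) \<^bold>\<and>
               rk_equiv R S (fmem2 R V) (pi_proj l ` W_set k) (pi_generic k l))"
          unfolding fand_iff gnd_iff by (intro exI[of _ t] exI[of _ l] conjI)
      qed
    qed
  qed
qed

end
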